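(* Let $k\ge1$. Equip $\mathbb{R}^{2k+1}$ and $\mathbb{R}^{2k+2}$ with the alternating forms $\omega_0(x,y)=\sum_i(-1)^{i-1}x_iy_i$. Let $\mathrm{OGr}_+(k,2k+1)$ be the set of $\omega_0$-isotropic $k$-dimensional subspaces of $\mathbb{R}^{2k+1}$ whose Plücker coordinates $p_I$ all have the same sign, and let $\mathrm{OGr}_+(k+1,2k+2)$ be the set of $\omega_0$-isotropic $(k+1)$-dimensional subspaces of $\mathbb{R}^{2k+2}$ whose Plücker coordinates $q_J$ all have the same sign and satisfy $q_J=q_{[2k+2]\setminus J}$ for all $J$ (the standard component). Then the linear map $$\Phi_k:(q_J)_J\mapsto(p_I)_I,\qquad p_I=q_{I\cup\{2k+2\}}\quad\Big(I\in\tbinom{[2k+1]}{k}\Big),$$ restricts to an isomorphism from $\mathrm{OGr}_+(k+1,2k+2)$ onto $\mathrm{OGr}_+(k,2k+1)$.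
   Context: A subspace $V$ is $\omega_0$-isotropic if $\omega_0(x,y)=0$ for all $x,y\in V$. The complex variety $\mathrm{OGr}(k+1,2k+2)$ of isotropic subspaces has two connected components; the standard one is where $q_J=q_{[2k+2]\setminus J}$ for all $(k+1)$-subsets $J$. *)

theory Defs
  imports
    "Jordan_Normal_Form.VS_Connect"
    "Jordan_Normal_Form.Determinant"
    "Jordan_Normal_Form.DL_Submatrix"
begin

text \<open>
  Coordinates are numbered from 0, so the index set \<open>[n]\<close> is \<open>{..<n}\<close>, the sign
  \<open>(-1)^(i-1)\<close> becomes \<open>(-1)^i\<close>, and the index \<open>2k+2\<close> of the last coordinate becomes \<open>2k+1\<close>.
\<close>

definition ksubsets :: "nat \<Rightarrow> nat \<Rightarrow> nat set set" where
  "ksubsets k n = {I. I \<subseteq> {..<n} \<and> card I = k}"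

definition omega0 :: "nat \<Rightarrow> real vec \<Rightarrow> real vec \<Rightarrow> real" where
  "omega0 n x y = (\<Sum>i<n. (-1) ^ i * (x $ i) * (y $ i))"

definition Gr :: "nat \<Rightarrow> nat \<Rightarrow> real vec set set" where
  "Gr k n = {V. VectorSpace.subspace class_ring V (module_vec TYPE(real) n) \<and>
     vectorspace.dim class_ring ((module_vec TYPE(real) n)\<lparr>carrier := V\<rparr>) = k}"

definition OGr :: "nat \<Rightarrow> nat \<Rightarrow> real vec set set" where
  "OGr k n = {V \<in> Gr k n. \<forall>x\<in>V. \<forall>y\<in>V. omega0 n x y = 0}"

subsection \<open>Projective space and Pluecker coordinates\<close>

text \<open>
  A point of the real projective space with homogeneous coordinates indexed by \<open>S\<close> is the set of
  all its coordinate vectors, i.e. a line through the origin with the origin removed.  Coordinate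
  vectors are functions vanishing outside \<open>S\<close>.
\<close>

definition proj_space :: "'i set \<Rightarrow> ('i \<Rightarrow> real) set set" where
  "proj_space S = {{(\<lambda>i. c * x i) | c. c \<noteq> 0} | x. (\<forall>i. i \<notin> S \<longrightarrow> x i = 0) \<and> (\<exists>i\<in>S. x i \<noteq> 0)}"

definition max_minors :: "nat \<Rightarrow> nat \<Rightarrow> real mat \<Rightarrow> nat set \<Rightarrow> real" where
  "max_minors k n A = (\<lambda>I. if I \<in> ksubsets k n then det (submatrix A UNIV I) else 0)"

text \<open>
  The vectors of maximal minors of all \<open>k \<times> n\<close> matrices whose rows form a basis of
  \<open>V \<in> Gr k n\<close>.  A change of basis multiplies such a vector by an arbitrary nonzero scalar, so for
  \<open>k \<ge> 1\<close> this set is the point of \<open>proj_space (ksubsets k n)\<close> given by the Pluecker embedding.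
\<close>

definition plucker :: "nat \<Rightarrow> nat \<Rightarrow> real vec set \<Rightarrow> (nat set \<Rightarrow> real) set" where
  "plucker k n V =
     {max_minors k n A | A. A \<in> carrier_mat k n \<and> vec_space.row_space n A = V}"

text \<open>
  ``All of the same sign'' is meant in the weak sense: up to a common scalar, all coordinates are
  nonnegative.
\<close>

definition OGr_plus :: "nat \<Rightarrow> nat \<Rightarrow> real vec set set" where
  "OGr_plus k n = {V \<in> OGr k n. \<forall>p \<in> plucker k n V.
     (\<forall>I \<in> ksubsets k n. p I \<ge> 0) \<or> (\<forall>I \<in> ksubsets k n. p I \<le> 0)}"

definition OGr_plus_std :: "nat \<Rightarrow> real vec set set" where
  "OGr_plus_std m = {W \<in> OGr_plus m (2 * m). \<forall>q \<in> plucker m (2 * m) W.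
     \<forall>J \<in> ksubsets m (2 * m). q J = q ({..<2 * m} - J)}"

subsection \<open>Isomorphisms between subsets of projective spaces\<close>

inductive homogeneous_poly_fun :: "'i set \<Rightarrow> nat \<Rightarrow> (('i \<Rightarrow> real) \<Rightarrow> real) \<Rightarrow> bool" for S where
  zero: "homogeneous_poly_fun S d (\<lambda>x. 0)"
| const: "homogeneous_poly_fun S 0 (\<lambda>x. c)"
| coord: "i \<in> S \<Longrightarrow> homogeneous_poly_fun S 1 (\<lambda>x. x i)"
| add: "homogeneous_poly_fun S d f \<Longrightarrow> homogeneous_poly_fun S d g \<Longrightarrow>
    homogeneous_poly_fun S d (\<lambda>x. f x + g x)"
| mult: "homogeneous_poly_fun S d f \<Longrightarrow> homogeneous_poly_fun S e g \<Longrightarrow>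
    homogeneous_poly_fun S (d + e) (\<lambda>x. f x * g x)"

text \<open>
  A map is regular if around each point of its domain \<open>X\<close> it is given by a tuple of homogeneous
  polynomials of one common degree, on the Zariski open subset of \<open>X\<close> where these polynomials do
  not vanish simultaneously.
\<close>

definition regular_map ::
  "'i set \<Rightarrow> 'j set \<Rightarrow> ('i \<Rightarrow> real) set set \<Rightarrow> (('i \<Rightarrow> real) set \<Rightarrow> ('j \<Rightarrow> real) set) \<Rightarrow> bool" where
  "regular_map S T X f \<longleftrightarrow> (\<forall>P\<in>X. \<exists>d F.
     (\<forall>j\<in>T. homogeneous_poly_fun S d (F j)) \<and>
     (\<forall>x\<in>P. \<exists>j\<in>T. F j x \<noteq> 0) \<and>
     (\<forall>Q\<in>X. \<forall>x\<in>Q. (\<exists>j\<in>T. F j x \<noteq> 0) \<longrightarrow> (\<lambda>j. if j \<in> T then F j x else 0) \<in> f Q))"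

definition proj_isomorphism ::
  "'i set \<Rightarrow> 'j set \<Rightarrow> ('i \<Rightarrow> real) set set \<Rightarrow> ('j \<Rightarrow> real) set set \<Rightarrow>
     (('i \<Rightarrow> real) set \<Rightarrow> ('j \<Rightarrow> real) set) \<Rightarrow> bool" where
  "proj_isomorphism S T X Y f \<longleftrightarrow>
     X \<subseteq> proj_space S \<and> Y \<subseteq> proj_space T \<and> bij_betw f X Y \<and>
     regular_map S T X f \<and> regular_map T S Y (inv_into X f)"

definition Phi :: "nat \<Rightarrow> (nat set \<Rightarrow> real) \<Rightarrow> (nat set \<Rightarrow> real)" where
  "Phi k q = (\<lambda>I. if I \<in> ksubsets k (2 * k + 1) then q (I \<union> {2 * k + 1}) else 0)"

end

theory Submission
  imports Defs "Jordan_Normal_Form.DL_Rank"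
begin

text \<open>
  The key fact is that the maximal minors of a matrix spanning an isotropic \<open>W \<in> OGr (k+1) (2k+2)\<close>
  satisfy \<open>q\<^sub>J = \<epsilon> q\<^sub>J\<^sub>c\<close> with a sign \<open>\<epsilon>\<close> independent of \<open>J\<close>.  Hence some nonzero \<open>q\<^sub>J\<close> has the
  last index in \<open>J\<close>, and \<open>W\<close> is the row space of a matrix \<open>[B, 0; u, 1]\<close>.  The rows of \<open>B\<close> span an
  isotropic \<open>V\<close> (the intersection of \<open>W\<close> with the last coordinate hyperplane) and the minors of
  \<open>B\<close> are the \<open>q\<^sub>J\<close> with the last index in \<open>J\<close>, so \<open>V\<close> has Pluecker vector \<open>Phi k q\<close>.
  Conversely, given \<open>V\<close>, pick \<open>u\<close> orthogonal to \<open>V\<close> with \<open>\<omega>\<^sub>0(u, u) = 1\<close>.  The two matrices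
  \<open>[B, 0; u, \<plusminus>1]\<close> span isotropic spaces whose signs \<open>\<epsilon>\<close> are opposite, so exactly one of them lies
  in the standard component; its remaining coordinates are those of \<open>V\<close> again, hence of one sign.
  The inverse of \<open>Phi\<close> reads off \<open>q\<^sub>J\<close> as a coordinate of \<open>p\<close> indexed by \<open>J\<close> or \<open>J\<^sup>c\<close> without the
  last index.
\<close>

subsection \<open>Minors and column selections\<close>

text \<open>Columns are chosen by an index function instead of a set, so that repeated columns and
  arbitrary orders can be expressed.\<close>

definition select_cols :: "'a mat \<Rightarrow> nat \<Rightarrow> (nat \<Rightarrow> nat) \<Rightarrow> 'a mat" where
  "select_cols A k c = mat (dim_row A) k (\<lambda>(i, j). A $$ (i, c j))"

lemma select_cols_carrier [simp]: "A \<in> carrier_mat r n \<Longrightarrow> select_cols A k c \<in> carrier_mat r k"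
  by (auto simp: select_cols_def)

lemma select_cols_mult:
  fixes A :: "'a :: semiring_0 mat"
  assumes "G \<in> carrier_mat r' r" "A \<in> carrier_mat r n" "c ` {..<k} \<subseteq> {..<n}"
  shows "select_cols (G * A) k c = G * select_cols A k c"
proof (rule eq_matI)
  fix i j assume "i < dim_row (G * select_cols A k c)" "j < dim_col (G * select_cols A k c)"
  moreover have "c j < n" if "j < k" for j using assms(3) that by auto
  ultimately show "select_cols (G * A) k c $$ (i, j) = (G * select_cols A k c) $$ (i, j)"
    using assms by (auto simp: select_cols_def scalar_prod_def)
qed (use assms in \<open>auto simp: select_cols_def\<close>)

lemma finite_ksubset: "I \<in> ksubsets k n \<Longrightarrow> finite I"
  by (auto simp: ksubsets_def intro: finite_subset)

lemma pick_less:
  assumes "I \<in> ksubsets k n" "i < k"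
  shows "pick I i < n"
  using pick_in_set_le[of i I] assms by (auto simp: ksubsets_def)

lemma bij_betw_pick:
  assumes "finite S"
  shows "bij_betw (pick S) {..<card S} S"
proof -
  have "inj_on (pick S) {..<card S}"
    by (intro inj_onI) (metis card_pick_le lessThan_iff)
  moreover have "pick S ` {..<card S} \<subseteq> S" using pick_in_set_le by auto
  ultimately show ?thesis
    using assms by (simp add: bij_betw_def card_image card_subset_eq)
qed

text \<open>Exactly the \<open>f a\<close> with \<open>a < i\<close> lie below \<open>f i\<close> in
  \<open>S\<close>, so \<open>f i\<close> has rank \<open>i\<close>. This computes
  \<open>pick\<close> on concretely given sets.\<close>

lemma pick_unique:
  assumes "strict_mono_on {..<card S} f" "f ` {..<card S} = S" "i < card S"
  shows "pick S i = f i"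
proof -
  have "{a \<in> S. a < f i} = f ` {..<i}"
  proof
    show "{a \<in> S. a < f i} \<subseteq> f ` {..<i}"
    proof
      fix a assume a: "a \<in> {a \<in> S. a < f i}"
      then obtain j where j: "j < card S" "a = f j" using assms(2) by auto
      then have "j < i" using a assms strict_mono_on_leD[OF assms(1), of i j] by force
      then show "a \<in> f ` {..<i}" using j by auto
    qed
    show "f ` {..<i} \<subseteq> {a \<in> S. a < f i}"
      using assms strict_mono_onD[OF assms(1)] by auto
  qed
  moreover have "inj_on f {..<i}"
    by (rule inj_on_subset[OF strict_mono_on_imp_inj_on[OF assms(1)]]) (use assms in auto)
  ultimately have "card {a \<in> S. a < f i} = i" by (simp add: card_image)
  then show ?thesis using pick_card_in_set[of "f i" S] assms by auto
qed

lemma submatrix_eq_select_cols: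
  assumes "A \<in> carrier_mat r n" "I \<in> ksubsets k n"
  shows "submatrix A UNIV I = select_cols A k (pick I)"
proof -
  have "{j. j < n \<and> j \<in> I} = I" using assms by (auto simp: ksubsets_def)
  then show ?thesis using assms
    by (auto simp: submatrix_def select_cols_def pick_UNIV ksubsets_def)
qed

lemma max_minors_eq:
  assumes "A \<in> carrier_mat r n" "I \<in> ksubsets k n"
  shows "max_minors k n A I = det (select_cols A k (pick I))"
  using assms by (simp add: max_minors_def submatrix_eq_select_cols)

lemma pick_image:
  assumes "I \<in> ksubsets k n"
  shows "pick I ` {..<k} = I"
  using bij_betw_pick[OF finite_ksubset[OF assms]] assms by (auto simp: bij_betw_def ksubsets_def)

lemma max_minors_mult:
  assumes "G \<in> carrier_mat k k" "A \<in> carrier_mat k n"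
  shows "max_minors k n (G * A) = (\<lambda>I. det G * max_minors k n A I)"
proof
  fix I
  show "max_minors k n (G * A) I = det G * max_minors k n A I"
  proof (cases "I \<in> ksubsets k n")
    case True
    then have "pick I ` {..<k} \<subseteq> {..<n}" using pick_image by (auto simp: ksubsets_def)
    then have "select_cols (G * A) k (pick I) = G * select_cols A k (pick I)"
      by (rule select_cols_mult[OF assms])
    then show ?thesis
      using True assms by (simp add: max_minors_eq[of _ k] det_mult[of _ k])
  qed (simp add: max_minors_def)
qed

text \<open>A repeated column gives \<open>s = 0\<close>; otherwise \<open>s\<close> is the sign of
  the permutation sorting the columns. Since \<open>s\<close> does not depend on \<open>A\<close>,
  matrices with equal maximal minors agree on every column selection.\<close>

lemma det_select_cols:
  assumes c: "c ` {..<k} \<subseteq> {..<n}"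
  obtains s :: real where
    "\<And>A. A \<in> carrier_mat k n \<Longrightarrow> det (select_cols A k c) = s * max_minors k n A (c ` {..<k})"
proof (cases "inj_on c {..<k}")
  case False
  then obtain i j where ij: "i < k" "j < k" "i \<noteq> j" "c i = c j" by (auto simp: inj_on_def)
  have "det (select_cols A k c) = 0" if "A \<in> carrier_mat k n" for A :: "real mat"
  proof (rule det_identical_columns[of _ k i j])
    show "col (select_cols A k c) i = col (select_cols A k c) j"
      using ij that by (intro eq_vecI) (auto simp: select_cols_def)
  qed (use ij that in auto)
  then show ?thesis by (intro that[of 0]) auto
next
  case True
  let ?I = "c ` {..<k}"
  have I: "?I \<in> ksubsets k n" using True c by (auto simp: ksubsets_def card_image)
  then have cI: "card ?I = k" by (simp add: ksubsets_def)
  have bp: "bij_betw (pick ?I) {..<k} ?I" using bij_betw_pick[of ?I] cI by auto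
  \<comment> \<open>The sorting permutation: \<open>p j\<close> is the position of
    \<open>c j\<close> in the increasing list of chosen columns, extended by the identity as
    \<open>permutes\<close> demands.\<close>
  define p where "p i = (if i < k then inv_into {..<k} (pick ?I) (c i) else i)" for i
  have bc: "bij_betw c {..<k} ?I" using True by (simp add: bij_betw_def)
  have "bij_betw (inv_into {..<k} (pick ?I) \<circ> c) {..<k} {..<k}"
    by (rule bij_betw_trans[OF bc bij_betw_inv_into[OF bp]])
  then have "bij_betw p {..<k} {..<k}"
    by (rule iffD1[OF bij_betw_cong, rotated]) (auto simp: p_def)
  then have p: "p permutes {0..<k}"
    by (intro bij_imp_permutes) (auto simp: p_def atLeast0LessThan)
  have pc: "pick ?I (p j) = c j" if "j < k" for j
    using that bij_betw_inv_into_right[OF bp, of "c j"] by (auto simp: p_def)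
  have "det (select_cols A k c) = signof p * max_minors k n A ?I" if A: "A \<in> carrier_mat k n" for A
  proof -
    let ?B = "select_cols A k (pick ?I)"
    have pk: "p j < k" if "j < k" for j using permutes_in_image[OF p] that by simp
    \<comment> \<open>The permutation rule for determinants concerns rows, hence the
      transposes.\<close>
    have "det (select_cols A k c) = det (transpose_mat (select_cols A k c))"
      using A by (simp add: det_transpose[of _ k])
    also have "transpose_mat (select_cols A k c) = mat k k (\<lambda>(i, j). transpose_mat ?B $$ (p i, j))"
      using A pc pk by (intro eq_matI) (auto simp: select_cols_def)
    also have "det \<dots> = signof p * det (transpose_mat ?B)"
      using A by (intro det_permute_rows p) auto
    also have "\<dots> = signof p * max_minors k n A ?I"
      using A I by (simp add: det_transpose[of _ k] max_minors_eq[of _ k])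
    finally show ?thesis .
  qed
  then show ?thesis by (rule that)
qed

text \<open>The Cauchy-Binet expansion before the terms with equal image are collected: expand every
  row of the product multilinearly. This form already suffices to detect a nonvanishing
  minor.\<close>

lemma det_mult_expand:
  fixes A B :: "'a :: comm_ring_1 mat"
  assumes A: "A \<in> carrier_mat k n" and B: "B \<in> carrier_mat n k"
  shows "det (A * B) = (\<Sum>f \<in> {0..<k} \<rightarrow>\<^sub>E {0..<n}.
    (\<Prod>i\<in>{0..<k}. A $$ (i, f i)) * det (mat k k (\<lambda>(i, j). B $$ (f i, j))))"
proof -
  let ?U = "{0..<k}" and ?P = "{p. p permutes {0..<k}}" and ?F = "{0..<k} \<rightarrow>\<^sub>E {0..<n}"
  have "det (A * B) = (\<Sum>p\<in>?P. signof p * (\<Prod>i\<in>?U. (A * B) $$ (i, p i)))"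
    using A B by (intro det_def') auto
  also have "\<dots> = (\<Sum>p\<in>?P. signof p * (\<Prod>i\<in>?U. \<Sum>l\<in>{0..<n}. A $$ (i, l) * B $$ (l, p i)))"
  proof (intro sum.cong prod.cong refl arg_cong2[of _ _ _ _ "(*)"])
    fix p i assume "p \<in> ?P" "i \<in> ?U"
    then have "i < k" "p i < k" using permutes_in_image[of p ?U i] by auto
    then show "(A * B) $$ (i, p i) = (\<Sum>l\<in>{0..<n}. A $$ (i, l) * B $$ (l, p i))"
      using A B by (auto simp: scalar_prod_def)
  qed
  also have "\<dots> = (\<Sum>p\<in>?P. \<Sum>f\<in>?F. signof p * (\<Prod>i\<in>?U. A $$ (i, f i) * B $$ (f i, p i)))"
    by (simp add: prod_sum_PiE sum_distrib_left)
  also have "\<dots> = (\<Sum>f\<in>?F. \<Sum>p\<in>?P. signof p * (\<Prod>i\<in>?U. A $$ (i, f i) * B $$ (f i, p i)))"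
    by (rule sum.swap)
  also have "\<dots> = (\<Sum>f\<in>?F. (\<Prod>i\<in>?U. A $$ (i, f i)) * det (mat k k (\<lambda>(i, j). B $$ (f i, j))))"
  proof (intro sum.cong refl)
    fix f
    have "det (mat k k (\<lambda>(i, j). B $$ (f i, j))) =
      (\<Sum>p\<in>?P. signof p * (\<Prod>i\<in>?U. mat k k (\<lambda>(i, j). B $$ (f i, j)) $$ (i, p i)))"
      by (intro det_def') auto
    also have "\<dots> = (\<Sum>p\<in>?P. signof p * (\<Prod>i\<in>?U. B $$ (f i, p i)))"
    proof (intro sum.cong prod.cong refl arg_cong2[of _ _ _ _ "(*)"])
      fix p i assume "p \<in> ?P" "i \<in> ?U"
      then have "i < k" "p i < k" using permutes_in_image[of p ?U i] by auto
      then show "mat k k (\<lambda>(i, j). B $$ (f i, j)) $$ (i, p i) = B $$ (f i, p i)" by simp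
    qed
    finally show "(\<Sum>p\<in>?P. signof p * (\<Prod>i\<in>?U. A $$ (i, f i) * B $$ (f i, p i))) =
      (\<Prod>i\<in>?U. A $$ (i, f i)) * det (mat k k (\<lambda>(i, j). B $$ (f i, j)))"
      by (simp add: prod.distrib sum_distrib_left mult_ac)
  qed
  finally show ?thesis .
qed

subsection \<open>Pluecker coordinates of row spaces\<close>

text \<open>Independence of the rows as a family; independence of the set of rows would overlook
  repetitions.\<close>

definition indep_rows :: "real mat \<Rightarrow> bool" where
  "indep_rows A \<longleftrightarrow> (\<forall>v \<in> carrier_vec (dim_row A). transpose_mat A *\<^sub>v v = 0\<^sub>v (dim_col A) \<longrightarrow> v = 0\<^sub>v (dim_row A))"

text \<open>If \<open>v\<close> is killed by the Gram matrix, then \<open>w\<close>, the transpose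
  of \<open>A\<close> applied to \<open>v\<close>, satisfies \<open>w \<bullet> w = 0\<close>. Over
  the reals this forces \<open>w = 0\<close>, hence \<open>v = 0\<close>.\<close>

lemma indep_rows_det_gram:
  assumes A: "A \<in> carrier_mat k n" and ind: "indep_rows A"
  shows "det (A * transpose_mat A) \<noteq> 0"
proof
  assume "det (A * transpose_mat A) = 0"
  then obtain v where v: "v \<in> carrier_vec k" "v \<noteq> 0\<^sub>v k" "(A * transpose_mat A) *\<^sub>v v = 0\<^sub>v k"
    using A det_0_iff_vec_prod_zero_field[of "A * transpose_mat A" k] by auto
  define w where "w = transpose_mat A *\<^sub>v v"
  have w: "w \<in> carrier_vec n" using A v by (auto simp: w_def)
  have "A *\<^sub>v w = 0\<^sub>v k" using A v by (simp add: w_def assoc_mult_mat_vec[of _ k n _ k])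
  then have "v \<bullet> (A *\<^sub>v w) = 0" using v by simp
  moreover have "v \<bullet> (A *\<^sub>v w) = w \<bullet> w"
    using transpose_vec_mult_scalar[OF A w v(1)] by (simp add: w_def)
  ultimately have "w \<bullet> w = 0" by simp
  then have z: "(\<Sum>i<n. (w $ i)\<^sup>2) = 0"
    using w by (simp add: scalar_prod_def power2_eq_square atLeast0LessThan)
  have "w $ i = 0" if "i < n" for i
  proof -
    have "(w $ i)\<^sup>2 \<le> (\<Sum>i<n. (w $ i)\<^sup>2)" by (rule member_le_sum) (use that in auto)
    then show ?thesis using z by simp
  qed
  then have "w = 0\<^sub>v n" using w by (intro eq_vecI) auto
  then show False using ind v A by (auto simp: indep_rows_def w_def)
qed

text \<open>Some term in the expansion of the nonzero Gram determinant survives, and its determinant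
  is a multiple of a maximal minor.\<close>

lemma indep_rows_nonzero_minor:
  assumes A: "A \<in> carrier_mat k n" and ind: "indep_rows A"
  obtains I where "I \<in> ksubsets k n" "max_minors k n A I \<noteq> 0"
proof -
  have "\<exists>f \<in> {0..<k} \<rightarrow>\<^sub>E {0..<n}. det (mat k k (\<lambda>(i, j). transpose_mat A $$ (f i, j))) \<noteq> 0"
  proof (rule ccontr)
    assume "\<not> ?thesis"
    then have "det (A * transpose_mat A) = 0"
      using A by (subst det_mult_expand[of _ k n]) auto
    then show False using indep_rows_det_gram[OF A ind] by simp
  qed
  then obtain f where f: "f \<in> {0..<k} \<rightarrow>\<^sub>E {0..<n}"
    and d: "det (mat k k (\<lambda>(i, j). transpose_mat A $$ (f i, j))) \<noteq> 0" by blast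
  have fn: "f i < n" if "i < k" for i using f that by (auto simp: PiE_def Pi_def)
  have "mat k k (\<lambda>(i, j). transpose_mat A $$ (f i, j)) = transpose_mat (select_cols A k f)"
    using A fn by (intro eq_matI) (auto simp: select_cols_def)
  then have d: "det (select_cols A k f) \<noteq> 0" using d A by (simp add: det_transpose[of _ k])
  have "f ` {..<k} \<subseteq> {..<n}" using fn by auto
  then obtain s where "det (select_cols A k f) = s * max_minors k n A (f ` {..<k})"
    using det_select_cols A by metis
  then have "max_minors k n A (f ` {..<k}) \<noteq> 0" using d by auto
  then show ?thesis by (intro that) (auto simp: max_minors_def split: if_splits)
qed

text \<open>A linear relation among the rows persists on the columns in \<open>I\<close>, where the
  square block is invertible.\<close>

lemma nonzero_minor_indep_rows:
  assumes A: "A \<in> carrier_mat k n" and I: "max_minors k n A I \<noteq> 0"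
  shows "indep_rows A"
  unfolding indep_rows_def
proof (intro ballI impI)
  fix v assume v: "v \<in> carrier_vec (dim_row A)" "transpose_mat A *\<^sub>v v = 0\<^sub>v (dim_col A)"
  have Ik: "I \<in> ksubsets k n" using I by (auto simp: max_minors_def split: if_splits)
  let ?B = "transpose_mat (select_cols A k (pick I))"
  have "det ?B \<noteq> 0" using I Ik A by (simp add: det_transpose[of _ k] max_minors_eq[of _ k])
  moreover have "?B *\<^sub>v v = 0\<^sub>v k"
  proof (rule eq_vecI)
    fix j assume j: "j < dim_vec (0\<^sub>v k :: real vec)"
    have "(?B *\<^sub>v v) $ j = (transpose_mat A *\<^sub>v v) $ pick I j"
      using j A v(1) pick_less[OF Ik, of j] by (auto simp: scalar_prod_def select_cols_def)
    then show "(?B *\<^sub>v v) $ j = 0\<^sub>v k $ j"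
      using j v A pick_less[OF Ik, of j] by auto
  qed (use A in \<open>auto simp: select_cols_def\<close>)
  ultimately show "v = 0\<^sub>v (dim_row A)"
    using v A det_0_iff_vec_prod_zero_field[of ?B k] by auto
qed

section \<open>Row spaces and change of basis\<close>

lemma row_space_eq_transpose:
  assumes "A \<in> carrier_mat k n"
  shows "vec_space.row_space n A = {transpose_mat A *\<^sub>v y | y. y \<in> carrier_vec k}"
  using assms by (auto simp: vec_space.row_space_eq[OF assms])

text \<open>Row \<open>i\<close> of \<open>G\<close> holds the coefficients of row \<open>i\<close>
  of \<open>A\<close> as a combination of the rows of \<open>B\<close>.\<close>

lemma row_space_subset_factor:
  assumes A: "A \<in> carrier_mat r n" and B: "B \<in> carrier_mat k n"
    and sub: "vec_space.row_space n A \<subseteq> vec_space.row_space n B"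
  obtains G where "G \<in> carrier_mat r k" "A = G * B"
proof -
  have "\<exists>y \<in> carrier_vec k. transpose_mat B *\<^sub>v y = row A i" if i: "i < r" for i
  proof -
    have "row A i = transpose_mat A *\<^sub>v unit_vec r i"
      using A i by (intro eq_vecI) auto
    then have "row A i \<in> vec_space.row_space n A" using i by (auto simp: row_space_eq_transpose[OF A])
    then have "row A i \<in> vec_space.row_space n B" using sub by blast
    then show ?thesis by (auto simp: row_space_eq_transpose[OF B])
  qed
  then obtain y where y: "\<And>i. i < r \<Longrightarrow> y i \<in> carrier_vec k \<and> transpose_mat B *\<^sub>v y i = row A i"
    by metis
  define G where "G = mat r k (\<lambda>(i, j). y i $ j)"
  have "A = G * B"
  proof (rule eq_matI)
    fix i j assume ij: "i < dim_row (G * B)" "j < dim_col (G * B)"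
    then have ij: "i < r" "j < n" using B by (auto simp: G_def)
    have "A $$ (i, j) = (transpose_mat B *\<^sub>v y i) $ j" using y A ij by simp
    also have "\<dots> = (G * B) $$ (i, j)"
      using conjunct1[OF y[OF ij(1)]] ij B by (auto simp: G_def scalar_prod_def mult.commute)
    finally show "A $$ (i, j) = (G * B) $$ (i, j)" .
  qed (use A B in \<open>auto simp: G_def\<close>)
  then show ?thesis by (intro that[of G]) (auto simp: G_def)
qed

lemma row_space_mult_subset:
  assumes "G \<in> carrier_mat r k" "B \<in> carrier_mat k n"
  shows "vec_space.row_space n (G * B) \<subseteq> vec_space.row_space n B"
proof
  fix x assume "x \<in> vec_space.row_space n (G * B)"
  then obtain y where y: "y \<in> carrier_vec r" "x = transpose_mat (G * B) *\<^sub>v y"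
    using assms by (auto simp: row_space_eq_transpose[of _ r])
  then have "x = transpose_mat B *\<^sub>v (transpose_mat G *\<^sub>v y)"
    using assms by (simp add: transpose_mult[of _ r k] assoc_mult_mat_vec[of _ n k _ r])
  then show "x \<in> vec_space.row_space n B"
    using assms y by (auto simp: row_space_eq_transpose[of _ k])
qed

lemma det_nonzero_inverse:
  assumes G: "G \<in> carrier_mat k k" and "det G \<noteq> (0 :: real)"
  obtains H where "H \<in> carrier_mat k k" "H * G = 1\<^sub>m k" "G * H = 1\<^sub>m k" "det H \<noteq> 0"
proof -
  obtain H where H: "H \<in> carrier_mat k k" "H * G = 1\<^sub>m k" "G * H = 1\<^sub>m k"
    using det_non_zero_imp_unit[OF assms(1)] assms(2)
    by (auto simp: Units_def ring_mat_def)
  have "det H * det G = 1" using H G det_mult[of H k G] by simp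
  then have "det H \<noteq> 0" by auto
  then show ?thesis using that H by blast
qed

lemma row_space_mult_invertible:
  assumes "G \<in> carrier_mat k k" "det G \<noteq> (0 :: real)" "B \<in> carrier_mat k n"
  shows "vec_space.row_space n (G * B) = vec_space.row_space n B"
proof
  obtain H where H: "H \<in> carrier_mat k k" "H * G = 1\<^sub>m k"
    using det_nonzero_inverse[OF assms(1,2)] by metis
  have "B = H * (G * B)" using H assms by (simp add: assoc_mult_mat[symmetric, of _ k k _ k _ n])
  then show "vec_space.row_space n B \<subseteq> vec_space.row_space n (G * B)"
    using row_space_mult_subset[of H k k "G * B" n] H assms by auto
qed (rule row_space_mult_subset[OF assms(1,3)])

text \<open>Two equal rows would put a difference of unit vectors into the kernel. Distinctness
  links \<open>indep_rows\<close> to the set-based \<open>lin_indpt\<close> through which dimensions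
  are computed.\<close>

lemma indep_rows_distinct:
  assumes A: "A \<in> carrier_mat k n" and "indep_rows A"
  shows "distinct (rows A)"
proof (rule ccontr)
  assume "\<not> distinct (rows A)"
  then obtain i j where ij: "i < k" "j < k" "i \<noteq> j" "row A i = row A j"
    using A by (auto simp: distinct_conv_nth)
  let ?v = "unit_vec k i - unit_vec k j :: real vec"
  have "transpose_mat A *\<^sub>v ?v = 0\<^sub>v n"
  proof (rule eq_vecI)
    fix l assume "l < dim_vec (0\<^sub>v n :: real vec)"
    moreover from this have "A $$ (i, l) = A $$ (j, l)"
      using ij A by (metis index_row(1) carrier_matD index_zero_vec(2))
    ultimately show "(transpose_mat A *\<^sub>v ?v) $ l = 0\<^sub>v n $ l"
      using A ij by (simp add: scalar_prod_minus_distrib[of _ k])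
  qed (use A in auto)
  then have "?v = 0\<^sub>v k" using assms by (auto simp: indep_rows_def)
  then have "?v $ i = 0" using ij by simp
  then show False using ij by simp
qed

section \<open>Subspaces and the matrices representing them\<close>

lemma indep_rows_row_space_Gr:
  assumes A: "A \<in> carrier_mat k n" and ind: "indep_rows A"
  shows "vec_space.row_space n A \<in> Gr k n"
proof -
  interpret vec_space "TYPE(real)" n .
  let ?B = "transpose_mat A"
  have B: "?B \<in> carrier_mat n k" using A by simp
  have d: "distinct (cols ?B)" using indep_rows_distinct[OF assms] by simp
  have "lin_indpt (set (cols ?B))"
  proof
    assume "lin_dep (set (cols ?B))"
    from lin_depE[OF B this d] show False
      using ind A by (auto simp: indep_rows_def)
  qed
  then have "rank ?B = k" using lin_indpt_full_rank[OF B d] by blast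
  then have "vectorspace.dim class_ring (vs (row_space A)) = k"
    by (simp add: rank_def row_space_def)
  moreover have "VectorSpace.subspace class_ring (row_space A) V"
    unfolding row_space_def using A rows_carrier[of A]
    by (intro span_is_subspace) auto
  ultimately show ?thesis by (simp add: Gr_def)
qed

lemma Gr_obtain_matrix:
  assumes "W \<in> Gr k n"
  obtains A where "A \<in> carrier_mat k n" "indep_rows A" "vec_space.row_space n A = W"
proof -
  interpret vec_space "TYPE(real)" n .
  have sub: "VectorSpace.subspace class_ring W V"
    and dimW: "vectorspace.dim class_ring (vs W) = k"
    using assms by (auto simp: Gr_def)
  then have subm: "submodule class_ring W V" by (simp add: subspace_def)
  then have WC: "W \<subseteq> carrier_vec n" using submodule.subset by fastforce
  interpret w: vectorspace class_ring "vs W" by (rule subspace_is_vs[OF sub])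
  have li: "w.lin_dep S = lin_dep S" if "S \<subseteq> W" for S
    using span_li_not_depend(2)[OF that subm] .
  \<comment> \<open>Independent subsets of \<open>W\<close> stay independent in the ambient space,
    so their size is at most \<open>n\<close>. A maximal one therefore exists and is a finite basis
    of \<open>W\<close>.\<close>
  have "\<exists>S. finite S \<and> maximal S (\<lambda>S. S \<subseteq> carrier (vs W) \<and> w.lin_indpt S)"
  proof (rule maximal_exists[where N = n and B = "{}"])
    fix S assume "S \<subseteq> carrier (vs W) \<and> w.lin_indpt S"
    then show "finite S \<and> card S \<le> n"
      using li_le_dim[of S] WC dim_is_n li[of S] by auto
  qed (auto simp: w.lin_dep_def)
  then obtain S where S: "finite S" "maximal S (\<lambda>S. S \<subseteq> carrier (vs W) \<and> w.lin_indpt S)" by blast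
  then have b: "w.basis S" by (intro w.max_li_is_basis) auto
  then have SW: "S \<subseteq> W" and "w.lin_indpt S" and "w.span S = W" by (auto simp: w.basis_def)
  then have lS: "lin_indpt S" and sS: "span S = W"
    using li[OF SW] span_li_not_depend(1)[OF SW subm] by auto
  have cS: "card S = k" using w.dim_basis[OF S(1) b] dimW by simp
  obtain xs where xs: "set xs = S" "distinct xs" using finite_distinct_list[OF S(1)] by blast
  then have len: "length xs = k" using cS distinct_card by metis
  have xc: "set xs \<subseteq> carrier_vec n" using xs SW WC by auto
  define A where "A = mat_of_rows n xs"
  have A: "A \<in> carrier_mat k n" using len by (auto simp: A_def)
  have rA: "rows A = xs" using xc by (simp add: A_def)
  have "row_space A = W" using sS rA xs by (simp add: row_space_def)
  moreover have "indep_rows A"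
    unfolding indep_rows_def
  proof (intro ballI impI)
    fix v assume v: "v \<in> carrier_vec (dim_row A)" "transpose_mat A *\<^sub>v v = 0\<^sub>v (dim_col A)"
    show "v = 0\<^sub>v (dim_row A)"
    proof (rule ccontr)
      assume "v \<noteq> 0\<^sub>v (dim_row A)"
      then have "lin_dep (set (cols (transpose_mat A)))"
        using v A xs rA by (intro lin_depI[of _ k v]) auto
      then show False using lS rA xs by simp
    qed
  qed
  ultimately show ?thesis using A that by blast
qed

text \<open>Each matrix factors through the other, by \<open>G\<close> and \<open>H\<close>.
  Comparing a nonzero minor of \<open>B\<close> with itself gives
  \<open>det H * det G = 1\<close>.\<close>

lemma same_row_space:
  assumes A: "A \<in> carrier_mat k n" and B: "B \<in> carrier_mat k n" and ind: "indep_rows B"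
    and eq: "vec_space.row_space n A = vec_space.row_space n B"
  obtains G where "G \<in> carrier_mat k k" "det G \<noteq> 0" "A = G * B"
proof -
  obtain G where G: "G \<in> carrier_mat k k" "A = G * B"
    using row_space_subset_factor[OF A B] eq by blast
  obtain H where H: "H \<in> carrier_mat k k" "B = H * A"
    using row_space_subset_factor[OF B A] eq by blast
  obtain I where I: "max_minors k n B I \<noteq> 0" using indep_rows_nonzero_minor[OF B ind] by blast
  have "max_minors k n B I = det H * (det G * max_minors k n B I)"
    using max_minors_mult[OF H(1) A] max_minors_mult[OF G(1) B] G(2) H(2) by metis
  then have "det G \<noteq> 0" using I by auto
  then show ?thesis using that G by blast
qed

lemma plucker_row_space:
  assumes A: "A \<in> carrier_mat k n" and ind: "indep_rows A" and k: "k \<ge> 1"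
  shows "plucker k n (vec_space.row_space n A) = {(\<lambda>I. c * max_minors k n A I) | c. c \<noteq> 0}"
proof (intro equalityI subsetI)
  fix p assume "p \<in> plucker k n (vec_space.row_space n A)"
  then obtain B where B: "B \<in> carrier_mat k n" "vec_space.row_space n B = vec_space.row_space n A"
    "p = max_minors k n B" by (auto simp: plucker_def)
  obtain G where "G \<in> carrier_mat k k" "det G \<noteq> 0" "B = G * A"
    using same_row_space[OF B(1) A ind B(2)] by blast
  then show "p \<in> {(\<lambda>I. c * max_minors k n A I) | c. c \<noteq> 0}"
    using B(3) max_minors_mult[OF _ A] by auto
next
  fix p assume "p \<in> {(\<lambda>I. c * max_minors k n A I) | c. c \<noteq> 0}"
  then obtain c where c: "c \<noteq> 0" "p = (\<lambda>I. c * max_minors k n A I)" by auto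
  \<comment> \<open>Scaling one row by \<open>c\<close> keeps the row space and multiplies all
    minors by \<open>c\<close>; \<open>k \<ge> 1\<close> provides row \<open>0\<close>.\<close>
  let ?G = "multrow_mat k 0 c"
  have G: "?G \<in> carrier_mat k k" "det ?G = c" using k by (auto simp: det_multrow_mat)
  then have "p = max_minors k n (?G * A)" using max_minors_mult[OF G(1) A] c by simp
  moreover have "vec_space.row_space n (?G * A) = vec_space.row_space n A"
    using row_space_mult_invertible[OF G(1) _ A] G(2) c(1) by simp
  ultimately show "p \<in> plucker k n (vec_space.row_space n A)"
    using G A by (auto simp: plucker_def intro!: exI[of _ "?G * A"])
qed

lemma plucker_in_proj_space:
  assumes "V \<in> Gr k n" "k \<ge> 1"
  shows "plucker k n V \<in> proj_space (ksubsets k n)"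
proof -
  obtain A where A: "A \<in> carrier_mat k n" "indep_rows A" "vec_space.row_space n A = V"
    using Gr_obtain_matrix[OF assms(1)] by blast
  obtain I where "I \<in> ksubsets k n" "max_minors k n A I \<noteq> 0"
    using indep_rows_nonzero_minor[OF A(1,2)] by blast
  then show ?thesis
    using plucker_row_space[OF A(1,2) assms(2)] A(3)
    by (auto simp: proj_space_def max_minors_def intro!: exI[of _ "max_minors k n A"])
qed

section \<open>Normal forms and injectivity of the Pluecker embedding\<close>

lemma Gr_normal_form:
  assumes "A \<in> carrier_mat k n" "J \<in> ksubsets k n" "max_minors k n A J \<noteq> 0"
  obtains G where "G \<in> carrier_mat k k" "det G * max_minors k n A J = 1"
    "select_cols (G * A) k (pick J) = 1\<^sub>m k"
    "vec_space.row_space n (G * A) = vec_space.row_space n A"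
proof -
  let ?B = "select_cols A k (pick J)"
  have B: "?B \<in> carrier_mat k k" "det ?B \<noteq> 0" "max_minors k n A J = det ?B"
    using assms by (auto simp: max_minors_eq[of _ k])
  \<comment> \<open>\<open>G\<close> is the inverse of the column block at \<open>J\<close>, so its
    determinant is the reciprocal of that minor.\<close>
  then obtain G where G: "G \<in> carrier_mat k k" "G * ?B = 1\<^sub>m k" "det G \<noteq> 0"
    using det_nonzero_inverse by metis
  have "pick J ` {..<k} \<subseteq> {..<n}" using pick_less[OF assms(2)] by auto
  then have "select_cols (G * A) k (pick J) = 1\<^sub>m k"
    using select_cols_mult[OF G(1) assms(1)] G(2) by simp
  moreover have "det G * max_minors k n A J = 1" using det_mult[OF G(1) B(1)] G(2) B(3) by simp
  ultimately show ?thesis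
    using that[OF G(1)] row_space_mult_invertible[OF G(1,3) assms(1)] by blast
qed

text \<open>Cramer's rule: the selected matrix is the identity with column \<open>i\<close> replaced
  by column \<open>j\<close> of \<open>B\<close>. Thus every entry of a normal form is determined by
  the maximal minors.\<close>

lemma normal_form_entry:
  assumes B: "B \<in> carrier_mat k n" and one: "select_cols B k (pick J) = 1\<^sub>m k"
    and ij: "i < k" "j < n"
  shows "B $$ (i, j) = det (select_cols B k ((pick J)(i := j)))"
proof -
  have "select_cols B k ((pick J)(i := j)) = replace_col (1\<^sub>m k) (1\<^sub>m k *\<^sub>v col B j) i"
  proof (rule eq_matI)
    fix a b assume "a < dim_row (replace_col (1\<^sub>m k) (1\<^sub>m k *\<^sub>v col B j) i)"
     "b < dim_col (replace_col (1\<^sub>m k) (1\<^sub>m k *\<^sub>v col B j) i)"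
    then have ab: "a < k" "b < k" by (auto simp: replace_col_def)
    have "B $$ (a, pick J b) = select_cols B k (pick J) $$ (a, b)"
      using B ab by (simp add: select_cols_def)
    moreover have "col B j \<in> carrier_vec k" using B ij by auto
    ultimately show "select_cols B k ((pick J)(i := j)) $$ (a, b) =
      replace_col (1\<^sub>m k) (1\<^sub>m k *\<^sub>v col B j) i $$ (a, b)"
      using B ij ab by (auto simp: replace_col_def one) (auto simp: select_cols_def)
  qed (use B in \<open>auto simp: select_cols_def replace_col_def\<close>)
  then show ?thesis
    using cramer_lemma_mat[of "1\<^sub>m k" k "col B j" i] B ij by auto
qed

text \<open>Choose bases with equal minors and normalize both at the same \<open>J\<close>; the
  normal forms coincide entry by entry.\<close>

lemma plucker_inj:
  assumes "V \<in> Gr k n" "V' \<in> Gr k n" "plucker k n V = plucker k n V'"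
  shows "V = V'"
proof -
  obtain A where A: "A \<in> carrier_mat k n" "indep_rows A" "vec_space.row_space n A = V"
    using Gr_obtain_matrix[OF assms(1)] by blast
  then have "max_minors k n A \<in> plucker k n V'" using assms(3) by (auto simp: plucker_def)
  then obtain A' where A': "A' \<in> carrier_mat k n" "vec_space.row_space n A' = V'"
    and mm: "max_minors k n A' = max_minors k n A" by (auto simp: plucker_def)
  obtain J where J: "J \<in> ksubsets k n" "max_minors k n A J \<noteq> 0"
    using indep_rows_nonzero_minor[OF A(1,2)] by blast
  obtain G where G: "G \<in> carrier_mat k k" "det G * max_minors k n A J = 1"
    "select_cols (G * A) k (pick J) = 1\<^sub>m k" "vec_space.row_space n (G * A) = vec_space.row_space n A"
    using Gr_normal_form[OF A(1) J] by metis
  obtain G' where G': "G' \<in> carrier_mat k k" "det G' * max_minors k n A' J = 1"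
    "select_cols (G' * A') k (pick J) = 1\<^sub>m k" "vec_space.row_space n (G' * A') = vec_space.row_space n A'"
    using Gr_normal_form[OF A'(1) J(1)] J(2) mm by metis
  \<comment> \<open>Both scalars are the reciprocal of the same minor, so normalizing keeps the
    minors equal.\<close>
  have "det G = det G'" using G(2) G'(2) mm J(2) by (metis mult_cancel_right)
  then have eq: "max_minors k n (G * A) = max_minors k n (G' * A')"
    using max_minors_mult[OF G(1) A(1)] max_minors_mult[OF G'(1) A'(1)] mm by simp
  have c: "G * A \<in> carrier_mat k n" "G' * A' \<in> carrier_mat k n" using G G' A A' by auto
  have "G * A = G' * A'"
  proof (rule eq_matI)
    fix i j assume "i < dim_row (G' * A')" "j < dim_col (G' * A')"
    then have ij: "i < k" "j < n" using c by auto
    have "((pick J)(i := j)) ` {..<k} \<subseteq> {..<n}" using ij pick_less[OF J(1)] by auto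
    then obtain s where s: "\<And>A. A \<in> carrier_mat k n \<Longrightarrow> det (select_cols A k ((pick J)(i := j)))
      = s * max_minors k n A (((pick J)(i := j)) ` {..<k})"
      using det_select_cols[of "(pick J)(i := j)" k n] by blast
    show "(G * A) $$ (i, j) = (G' * A') $$ (i, j)"
      using normal_form_entry[OF c(1) G(3) ij] normal_form_entry[OF c(2) G'(3) ij]
        s[OF c(1)] s[OF c(2)] eq by simp
  qed (use A A' G G' in auto)
  then show ?thesis using A A' G G' by simp
qed

subsection \<open>Complementary minors of isotropic matrices\<close>

text \<open>For an \<open>m\<close>-subset \<open>J\<close> of \<open>{..<2 * m}\<close>, this is
  the one-line form of the shuffle putting \<open>J\<close> before its complement.\<close>

definition merge_pick :: "nat \<Rightarrow> nat set \<Rightarrow> nat \<Rightarrow> nat" where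
  "merge_pick m J i = (if i < m then pick J i else pick ({..<2 * m} - J) (i - m))"

lemma ksubsets_complement:
  assumes "J \<in> ksubsets m (2 * m)"
  shows "{..<2 * m} - J \<in> ksubsets m (2 * m)"
  using assms finite_ksubset[OF assms] by (auto simp: ksubsets_def card_Diff_subset)

text \<open>Exchanging two neighbours of which only one lies in \<open>S\<close> keeps the relative
  order of the elements of \<open>S\<close>, so increasing enumerations go to increasing
  enumerations.\<close>

lemma pick_transpose:
  assumes "finite S" "(j \<in> S) \<noteq> (Suc j \<in> S)" "i < card S"
  shows "pick (transpose j (Suc j) ` S) i = transpose j (Suc j) (pick S i)"
proof -
  let ?t = "transpose j (Suc j)" and ?S = "transpose j (Suc j) ` S"
  have c: "card ?S = card S" by (intro card_image inj_on_subset[OF inj_transpose]) auto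
  have b: "pick S ` {..<card S} = S" using bij_betw_pick[OF assms(1)] by (simp add: bij_betw_def)
  have "strict_mono_on {..<card ?S} (?t \<circ> pick S)"
  proof (rule strict_mono_onI)
    fix a b assume ab: "a \<in> {..<card ?S}" "b \<in> {..<card ?S}" "a < b"
    then have "pick S a < pick S b" "pick S a \<in> S" "pick S b \<in> S"
      using c pick_mono_le[of b S a] pick_in_set_le[of a S] pick_in_set_le[of b S] by auto
    moreover from this have "\<not> (pick S a = j \<and> pick S b = Suc j)" using assms(2) by auto
    ultimately show "(?t \<circ> pick S) a < (?t \<circ> pick S) b"
      by (auto simp: transpose_def)
  qed
  moreover have "(?t \<circ> pick S) ` {..<card ?S} = ?S"
    unfolding c image_comp[symmetric] b ..
  ultimately show ?thesis using pick_unique[of ?S "?t \<circ> pick S" i] assms(3) c by simp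
qed

text \<open>The sign of the shuffle, by induction on \<open>\<Sum>J\<close>: moving an element of
  \<open>J\<close> down by one into a free place lowers the sum by one and swaps two
  columns.\<close>

lemma det_select_merge_pick:
  fixes M :: "real mat"
  assumes "J \<in> ksubsets m (2 * m)" "M \<in> carrier_mat (2 * m) (2 * m)"
  shows "(-1) ^ (\<Sum>J) * det (select_cols M (2 * m) (merge_pick m J)) = (-1) ^ (\<Sum>{..<m}) * det M"
  using assms
proof (induction "\<Sum>J" arbitrary: J M rule: less_induct)
  case less
  note J = less.prems(1) and M = less.prems(2)
  have fJ: "finite J" and cJ: "card J = m" and sJ: "J \<subseteq> {..<2 * m}"
    using finite_ksubset[OF J] J by (auto simp: ksubsets_def)
  show ?case
  proof (cases "\<exists>j. Suc j \<in> J \<and> j \<notin> J")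
    case False
    \<comment> \<open>With no free place below an element, \<open>J\<close> is downward closed,
      hence an initial segment, and the shuffle is the identity.\<close>
    have "J = {..<m}"
    proof -
      have down: "i \<in> J" if "i \<le> j" "j \<in> J" for i j
        using that by (induction rule: inc_induct) (use False in auto)
      have "J \<subseteq> {..<m}"
      proof
        fix j assume "j \<in> J"
        then have "{..j} \<subseteq> J" using down by auto
        then have "card {..j} \<le> m" using card_mono[OF fJ] cJ by metis
        then show "j \<in> {..<m}" by simp
      qed
      then show ?thesis using cJ by (intro card_subset_eq) auto
    qed
    moreover have "pick {..<m} i = i" if "i < m" for i
      using pick_unique[of "{..<m}" "\<lambda>i. i" i] that by (auto simp: strict_mono_on_def)
    moreover have "pick ({..<2 * m} - {..<m}) i = m + i" if "i < m" for i
    proof -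
      have S: "{..<2 * m} - {..<m} = {m..<2 * m}" by auto
      have "(\<lambda>i. m + i) ` {..<card {m..<2 * m}} = {m..<2 * m}"
        by (simp add: lessThan_atLeast0 image_add_atLeastLessThan mult_2)
      then show ?thesis
        unfolding S using that pick_unique[of "{m..<2 * m}" "\<lambda>i. m + i" i]
        by (auto simp: strict_mono_on_def)
    qed
    ultimately have "merge_pick m J i = i" if "i < 2 * m" for i
      using that by (auto simp: merge_pick_def)
    then have "select_cols M (2 * m) (merge_pick m J) = M"
      using M by (intro eq_matI) (auto simp: select_cols_def)
    then show ?thesis using \<open>J = {..<m}\<close> by simp
  next
    case True
    then obtain j where j: "Suc j \<in> J" "j \<notin> J" by blast
    then have j2: "Suc j < 2 * m" using sJ by auto
    let ?t = "transpose j (Suc j)"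
    define J' where "J' = ?t ` J"
    have J'eq: "J' = insert j (J - {Suc j})"
    proof -
      have "?t ` J = insert (?t (Suc j)) (?t ` (J - {Suc j}))"
        using j(1) by (metis insert_Diff image_insert)
      also have "?t ` (J - {Suc j}) = id ` (J - {Suc j})"
        using j by (intro image_cong) (auto simp: transpose_def)
      finally show ?thesis by (simp add: J'_def)
    qed
    have sum: "\<Sum>J = Suc (\<Sum>J')"
      using j fJ sum.remove[OF fJ j(1), of "\<lambda>x. x"] by (simp add: J'eq)
    have J': "J' \<in> ksubsets m (2 * m)"
      using J j j2 fJ cJ card_Suc_Diff1[OF fJ j(1)] unfolding ksubsets_def J'eq by auto
    have comp: "{..<2 * m} - J' = ?t ` ({..<2 * m} - J)"
    proof -
      have "?t ` ({..<2 * m} - J) = ?t ` {..<2 * m} - J'"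
        by (simp add: J'_def image_set_diff)
      moreover have "?t ` {..<2 * m} = {..<2 * m}"
        by (rule permutes_image[OF permutes_swap_id]) (use j2 in auto)
      ultimately show ?thesis by simp
    qed
    have cc: "card ({..<2 * m} - J) = m" using ksubsets_complement[OF J] by (simp add: ksubsets_def)
    have mp: "merge_pick m J' i = ?t (merge_pick m J i)" if "i < 2 * m" for i
    proof (cases "i < m")
      case True
      then show ?thesis using pick_transpose[OF fJ, of j i] j cJ by (simp add: merge_pick_def J'_def)
    next
      case False
      then show ?thesis
        using pick_transpose[of "{..<2 * m} - J" j "i - m"] j j2 cc that
        by (simp add: merge_pick_def comp)
    qed
    have ml: "merge_pick m J i < 2 * m" if "i < 2 * m" for i
      using that pick_less[OF J] pick_less[OF ksubsets_complement[OF J]]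
      by (auto simp: merge_pick_def)
    let ?M = "swapcols j (Suc j) M"
    have M': "?M \<in> carrier_mat (2 * m) (2 * m)" using M by simp
    \<comment> \<open>Swapping the columns of \<open>M\<close> compensates the transposition of the
      indices; the determinant and the sign attached to the sum both change sign.\<close>
    have "select_cols M (2 * m) (merge_pick m J) = select_cols ?M (2 * m) (merge_pick m J')"
      using M mp ml j2 by (intro eq_matI) (auto simp: select_cols_def mat_swapcols_def transpose_def)
    moreover have "det ?M = - det M" using M j2 by (intro det_swapcols) auto
    ultimately show ?thesis
      using less.hyps[OF _ J' M'] sum by simp
  qed
qed

section \<open>Isotropic matrices and duality of their minors\<close>

definition isotropic_rows :: "real mat \<Rightarrow> bool" where
  "isotropic_rows A \<longleftrightarrow> (\<forall>i < dim_row A. \<forall>j < dim_row A.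
     (\<Sum>l < dim_col A. (-1) ^ l * A $$ (i, l) * A $$ (j, l)) = 0)"

lemma sum_pick_split:
  fixes f :: "nat \<Rightarrow> real"
  assumes J: "J \<in> ksubsets m (2 * m)"
  shows "(\<Sum>l = 0..<m. f (pick J l)) + (\<Sum>l = 0..<m. f (pick ({..<2 * m} - J) l)) = (\<Sum>l<2 * m. f l)"
proof -
  have *: "(\<Sum>l = 0..<m. f (pick S l)) = sum f S" if "S \<in> ksubsets m (2 * m)" for S
    using sum.reindex_bij_betw[OF bij_betw_pick[OF finite_ksubset[OF that]], of f] that
    by (simp add: ksubsets_def atLeast0LessThan)
  show ?thesis
    unfolding *[OF J] *[OF ksubsets_complement[OF J]]
    using J sum.subset_diff[of J "{..<2 * m}" f] by (simp add: ksubsets_def)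
qed

lemma det_sign_cols:
  assumes A: "A \<in> carrier_mat m n" and J: "J \<in> ksubsets m n"
  shows "det (select_cols (mat m n (\<lambda>(i, j). (-1) ^ j * A $$ (i, j))) m (pick J))
    = (-1) ^ (\<Sum>J) * (max_minors m n A J :: real)"
proof -
  let ?B = "select_cols A m (pick J)"
  let ?D = "mat m m (\<lambda>(i, j). if i = j then (-1) ^ pick J i else 0) :: real mat"
  have "select_cols (mat m n (\<lambda>(i, j). (-1) ^ j * A $$ (i, j))) m (pick J) = ?B * ?D"
  proof (rule eq_matI)
    fix i j assume ij: "i < dim_row (?B * ?D)" "j < dim_col (?B * ?D)"
    then have "i < m" "j < m" using A by (auto simp: select_cols_def)
    then show "select_cols (mat m n (\<lambda>(i, j). (-1) ^ j * A $$ (i, j))) m (pick J) $$ (i, j) = (?B * ?D) $$ (i, j)"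
      using A pick_less[OF J, of j]
      by (simp add: select_cols_def scalar_prod_def if_distrib sum.delta cong: if_cong)
  qed (use A in \<open>auto simp: select_cols_def\<close>)
  then have "det (select_cols (mat m n (\<lambda>(i, j). (-1) ^ j * A $$ (i, j))) m (pick J)) = det ?B * det ?D"
    using A by (simp add: det_mult[of _ m])
  moreover have "det ?D = (\<Prod>i = 0..<m. (-1) ^ pick J i)"
    by (subst det_upper_triangular[of _ m]) (auto simp: prod_list_diag_prod)
  moreover have "(\<Prod>i = 0..<m. (-1) ^ pick J i) = ((-1) ^ (\<Sum>J) :: real)"
  proof -
    have "(\<Sum>i = 0..<m. pick J i) = \<Sum>J"
      using sum.reindex_bij_betw[OF bij_betw_pick[OF finite_ksubset[OF J]], of "\<lambda>x. x"] J
      by (simp add: ksubsets_def atLeast0LessThan)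
    then show ?thesis by (simp flip: power_sum)
  qed
  ultimately show ?thesis using A J by (simp add: max_minors_eq[of _ m])
qed

text \<open>
  Write \<open>D\<close> for the diagonal matrix of the form and \<open>X\<^sub>J\<close> for the columns of \<open>X\<close> in \<open>J\<close>.  With the
  columns of \<open>M = [A; A D]\<close> sorted as \<open>J, J\<^sup>c\<close>, isotropy gives
  \<open>[A\<^sub>J, A\<^sub>J\<^sub>c; (A D)\<^sub>J, (A D)\<^sub>J\<^sub>c] [1, (A D)\<^sub>J\<^sup>T; 0, (A D)\<^sub>J\<^sub>c\<^sup>T] = [A\<^sub>J, 0; (A D)\<^sub>J, A A\<^sup>T]\<close>,
  and the claim is the determinant of this identity: the sign \<open>(-1)^(\<Sum>J)\<close> of the sorting permutation
  and the factor \<open>(-1)^(\<Sum>J\<^sup>c)\<close> from \<open>D\<close> multiply to a constant.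
\<close>

lemma isotropic_complementary_minors:
  assumes A: "A \<in> carrier_mat m (2 * m)" and ind: "indep_rows A" and iso: "isotropic_rows A"
  obtains \<epsilon> where "\<epsilon> = 1 \<or> \<epsilon> = -1"
    "\<And>J. J \<in> ksubsets m (2 * m) \<Longrightarrow>
      max_minors m (2 * m) A J = \<epsilon> * max_minors m (2 * m) A ({..<2 * m} - J)"
proof -
  let ?n = "2 * m" and ?q = "max_minors m (2 * m) A"
  define sA where "sA = mat m ?n (\<lambda>(i, j). (-1) ^ j * A $$ (i, j))"
  have sA: "sA \<in> carrier_mat m ?n" by (simp add: sA_def)
  define M where "M = mat ?n ?n (\<lambda>(i, j). if i < m then A $$ (i, j) else sA $$ (i - m, j))"
  have M: "M \<in> carrier_mat ?n ?n" by (simp add: M_def)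
  define N where "N = A * transpose_mat A"
  have N: "N \<in> carrier_mat m m" and dN: "det N \<noteq> 0"
    using A indep_rows_det_gram[OF A ind] by (auto simp: N_def)
  \<comment> \<open>The factor left over when the determinant identity is solved for
    \<open>?q J\<close>; it involves no \<open>J\<close>.\<close>
  define \<epsilon> where "\<epsilon> = (-1) ^ (\<Sum>{..<m}) * (-1) ^ (\<Sum>{..<?n}) * det M / det N"
  have main: "?q J = \<epsilon> * ?q ({..<?n} - J)" if J: "J \<in> ksubsets m ?n" for J
  proof -
    let ?K = "{..<?n} - J"
    have K: "?K \<in> ksubsets m ?n" by (rule ksubsets_complement[OF J])
    let ?A = "\<lambda>S. select_cols A m (pick S)" and ?B = "\<lambda>S. select_cols sA m (pick S)"
    have c: "?A S \<in> carrier_mat m m" "?B S \<in> carrier_mat m m" for S using A sA by auto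
    have Mb: "select_cols M ?n (merge_pick m J) = four_block_mat (?A J) (?A ?K) (?B J) (?B ?K)"
      using A sA pick_less[OF J] pick_less[OF K]
      by (intro eq_matI) (auto simp: select_cols_def merge_pick_def M_def)
    let ?T = "four_block_mat (1\<^sub>m m) (transpose_mat (?B J)) (0\<^sub>m m m) (transpose_mat (?B ?K))"
    have z: "?A J * transpose_mat (?B J) + ?A ?K * transpose_mat (?B ?K) = 0\<^sub>m m m" (is "?L = _")
    proof (rule eq_matI)
      fix i j assume "i < dim_row (0\<^sub>m m m :: real mat)" "j < dim_col (0\<^sub>m m m :: real mat)"
      then have ij: "i < m" "j < m" by auto
      let ?f = "\<lambda>l. A $$ (i, l) * ((-1) ^ l * A $$ (j, l))"
      have "?L $$ (i, j) = (\<Sum>l = 0..<m. ?f (pick J l)) + (\<Sum>l = 0..<m. ?f (pick ?K l))"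
        using ij A pick_less[OF J] pick_less[OF K]
        by (simp add: select_cols_def scalar_prod_def sA_def)
      also have "\<dots> = (\<Sum>l<?n. ?f l)" by (rule sum_pick_split[OF J])
      also have "\<dots> = 0" using iso A ij by (simp add: isotropic_rows_def mult_ac)
      finally show "?L $$ (i, j) = 0\<^sub>m m m $$ (i, j)" using ij by simp
    qed (use c in auto)
    have g: "?B J * transpose_mat (?B J) + ?B ?K * transpose_mat (?B ?K) = N" (is "?L = _")
    proof (rule eq_matI)
      fix i j assume "i < dim_row N" "j < dim_col N"
      then have ij: "i < m" "j < m" using N by auto
      let ?f = "\<lambda>l. ((-1) ^ l * A $$ (i, l)) * ((-1) ^ l * A $$ (j, l))"
      have "?L $$ (i, j) = (\<Sum>l = 0..<m. ?f (pick J l)) + (\<Sum>l = 0..<m. ?f (pick ?K l))"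
        using ij A pick_less[OF J] pick_less[OF K]
        by (simp add: select_cols_def scalar_prod_def sA_def)
      also have "\<dots> = (\<Sum>l<?n. ?f l)" by (rule sum_pick_split[OF J])
      also have "\<dots> = (\<Sum>l<?n. A $$ (i, l) * A $$ (j, l))"
      proof (intro sum.cong refl)
        fix l :: nat
        have "(-1) ^ l * (-1) ^ l = (1 :: real)" by (simp flip: power_mult_distrib)
        then show "?f l = A $$ (i, l) * A $$ (j, l)" by (metis mult.assoc mult.left_commute mult_1)
      qed
      also have "\<dots> = N $$ (i, j)" using A ij by (simp add: N_def scalar_prod_def atLeast0LessThan)
      finally show "?L $$ (i, j) = N $$ (i, j)" .
    qed (use c N in auto)
    have "four_block_mat (?A J) (?A ?K) (?B J) (?B ?K) * ?T = four_block_mat (?A J) (0\<^sub>m m m) (?B J) N"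
      using c[of J] c[of ?K] N
      by (subst mult_four_block_mat[of _ m m _ m _ m _ _ m _ m])
        (auto simp: z g right_mult_zero_mat[of _ m m] right_mult_one_mat[of _ m m])
    moreover have "det (four_block_mat (?A J) (?A ?K) (?B J) (?B ?K) * ?T) =
        det (select_cols M ?n (merge_pick m J)) * det ?T"
      unfolding Mb[symmetric] using M c[of J] c[of ?K]
      by (intro det_mult[of _ ?n]) (auto simp: mult_2)
    moreover have "det (four_block_mat (?A J) (0\<^sub>m m m) (?B J) N) = det (?A J) * det N"
      using c N by (intro det_four_block_mat_upper_right_zero) auto
    moreover have "det ?T = det (transpose_mat (?B ?K))"
      using c by (subst det_four_block_mat_lower_left_zero[of _ m _ m]) auto
    moreover have "det (transpose_mat (?B ?K)) = (-1) ^ (\<Sum>?K) * ?q ?K"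
      using c det_sign_cols[OF A K] by (simp add: det_transpose[of _ m] sA_def)
    moreover have "det (?A J) = ?q J" using A J by (simp add: max_minors_eq[of _ m])
    ultimately have 1: "det (select_cols M ?n (merge_pick m J)) * ((-1) ^ (\<Sum>?K) * ?q ?K) = ?q J * det N"
      by simp
    have sq: "(-1) ^ a * (-1) ^ a = (1 :: real)" for a :: nat by (simp flip: power_mult_distrib)
    have "det (select_cols M ?n (merge_pick m J)) = (-1) ^ (\<Sum>J) * ((-1) ^ (\<Sum>{..<m}) * det M)"
      using det_select_merge_pick[OF J M] sq[of "\<Sum>J"] by (metis mult.assoc mult_1)
    moreover have "(-1) ^ (\<Sum>J) * (-1) ^ (\<Sum>?K) = ((-1) ^ (\<Sum>{..<?n}) :: real)"
      using J sum.subset_diff[of J "{..<?n}" "\<lambda>x. x"]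
      by (simp add: ksubsets_def add.commute flip: power_add)
    moreover have "?q J * det N = (-1) ^ (\<Sum>J) * (-1) ^ (\<Sum>?K) * ((-1) ^ (\<Sum>{..<m}) * det M * ?q ?K)"
      using 1 calculation(1) by (simp add: mult_ac)
    ultimately have "?q J * det N = (-1) ^ (\<Sum>{..<m}) * (-1) ^ (\<Sum>{..<?n}) * det M * ?q ?K"
      by (simp add: mult_ac)
    then show ?thesis using dN by (simp add: \<epsilon>_def field_simps)
  qed
  obtain J where J: "J \<in> ksubsets m ?n" "?q J \<noteq> 0" using indep_rows_nonzero_minor[OF A ind] by blast
  have "{..<?n} - ({..<?n} - J) = J" using J by (auto simp: ksubsets_def)
  \<comment> \<open>Complementing twice returns to \<open>J\<close>, so a nonzero minor forces
    \<epsilon> to be a square root of one.\<close>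
  then have "?q J = \<epsilon> * (\<epsilon> * ?q J)"
    using main[OF J(1)] main[OF ksubsets_complement[OF J(1)]] by simp
  then have "\<epsilon>\<^sup>2 = 1" using J(2) by (simp add: power2_eq_square)
  then have "\<epsilon> = 1 \<or> \<epsilon> = -1" by (simp add: power2_eq_1_iff)
  then show ?thesis using that main by blast
qed

subsection \<open>Adding a last row and column\<close>

lemma omega0_transpose_mult:
  assumes A: "A \<in> carrier_mat k n" and y: "y \<in> carrier_vec k" and z: "z \<in> carrier_vec k"
  shows "omega0 n (transpose_mat A *\<^sub>v y) (transpose_mat A *\<^sub>v z) =
    (\<Sum>i<k. \<Sum>j<k. y $ i * z $ j * (\<Sum>l<n. (-1) ^ l * A $$ (i, l) * A $$ (j, l)))"
proof -
  have e: "(transpose_mat A *\<^sub>v v) $ l = (\<Sum>i<k. A $$ (i, l) * v $ i)"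
    if "v \<in> carrier_vec k" "l < n" for v l
    using that A by (simp add: scalar_prod_def atLeast0LessThan)
  have "omega0 n (transpose_mat A *\<^sub>v y) (transpose_mat A *\<^sub>v z) =
    (\<Sum>l<n. \<Sum>i<k. \<Sum>j<k. (-1) ^ l * (A $$ (i, l) * y $ i) * (A $$ (j, l) * z $ j))"
    unfolding omega0_def using y z
    by (intro sum.cong refl) (simp add: e sum_distrib_left sum_distrib_right, rule sum.swap)
  also have "\<dots> = (\<Sum>i<k. \<Sum>l<n. \<Sum>j<k. (-1) ^ l * (A $$ (i, l) * y $ i) * (A $$ (j, l) * z $ j))"
    by (rule sum.swap)
  also have "\<dots> = (\<Sum>i<k. \<Sum>j<k. \<Sum>l<n. (-1) ^ l * (A $$ (i, l) * y $ i) * (A $$ (j, l) * z $ j))"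
    by (intro sum.cong refl sum.swap)
  also have "\<dots> = (\<Sum>i<k. \<Sum>j<k. y $ i * z $ j * (\<Sum>l<n. (-1) ^ l * A $$ (i, l) * A $$ (j, l)))"
    by (simp add: sum_distrib_left mult_ac)
  finally show ?thesis .
qed

lemma row_space_isotropic_iff:
  assumes A: "A \<in> carrier_mat k n"
  shows "(\<forall>x \<in> vec_space.row_space n A. \<forall>y \<in> vec_space.row_space n A. omega0 n x y = 0) \<longleftrightarrow> isotropic_rows A"
    (is "?L \<longleftrightarrow> ?R")
proof
  assume ?R
  then show ?L using A by (auto simp: row_space_eq_transpose[OF A] omega0_transpose_mult[OF A] isotropic_rows_def)
next
  assume L: ?L
  have "row A i \<in> vec_space.row_space n A" if "i < k" for i
  proof -
    have "row A i = transpose_mat A *\<^sub>v unit_vec k i" using A that by (intro eq_vecI) auto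
    then show ?thesis using that by (auto simp: row_space_eq_transpose[OF A])
  qed
  then have "omega0 n (row A i) (row A j) = 0" if "i < k" "j < k" for i j using L that by blast
  then show ?R using A by (auto simp: isotropic_rows_def omega0_def)
qed

lemma OGr_obtain_matrix:
  assumes "W \<in> OGr k n"
  obtains A where "A \<in> carrier_mat k n" "indep_rows A" "isotropic_rows A" "vec_space.row_space n A = W"
proof -
  obtain A where A: "A \<in> carrier_mat k n" "indep_rows A" "vec_space.row_space n A = W"
    using assms Gr_obtain_matrix[of W k n] by (auto simp: OGr_def)
  then have "isotropic_rows A" using assms row_space_isotropic_iff[OF A(1)] by (auto simp: OGr_def)
  then show ?thesis using that A by blast
qed

lemma row_space_OGr:
  assumes "A \<in> carrier_mat k n" "indep_rows A" "isotropic_rows A"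
  shows "vec_space.row_space n A \<in> OGr k n"
  using assms indep_rows_row_space_Gr row_space_isotropic_iff[OF assms(1)] by (auto simp: OGr_def)

text \<open>The corner \<open>s\<close> is kept as a parameter: its values \<open>1\<close> and
  \<open>-1\<close> give the two isotropic extensions of \<open>B\<close> by the same
  \<open>u\<close>.\<close>

definition ext_mat :: "real mat \<Rightarrow> real vec \<Rightarrow> real \<Rightarrow> real mat" where
  "ext_mat B u s = mat (Suc (dim_row B)) (Suc (dim_col B)) (\<lambda>(i, j).
     if i < dim_row B then if j < dim_col B then B $$ (i, j) else 0
     else if j < dim_col B then u $ j else s)"

lemma ext_mat_carrier [simp]: "B \<in> carrier_mat k n \<Longrightarrow> ext_mat B u s \<in> carrier_mat (Suc k) (Suc n)"
  by (simp add: ext_mat_def)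

lemma ksubsets_insert_last:
  assumes "I \<in> ksubsets k n"
  shows "insert n I \<in> ksubsets (Suc k) (Suc n)"
  using assms finite_ksubset[OF assms] by (auto simp: ksubsets_def card_insert_if)

lemma ksubsets_remove_last:
  assumes "J \<in> ksubsets (Suc k) (Suc n)" "n \<in> J"
  shows "J - {n} \<in> ksubsets k n"
  using assms finite_ksubset[OF assms(1)] by (auto simp: ksubsets_def less_Suc_eq)

lemma pick_insert_last:
  assumes I: "I \<in> ksubsets k n" and i: "i < Suc k"
  shows "pick (insert n I) i = (if i < k then pick I i else n)"
proof -
  let ?f = "\<lambda>i. if i < k then pick I i else n"
  have cI: "card I = k" using I by (simp add: ksubsets_def)
  have c: "card (insert n I) = Suc k" using ksubsets_insert_last[OF I] by (simp add: ksubsets_def)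
  have "strict_mono_on {..<Suc k} ?f"
    using pick_less[OF I] pick_mono_le[of _ I] cI by (auto intro!: strict_mono_onI)
  moreover have "?f ` {..<Suc k} = insert n I"
    using pick_image[OF I] by (auto simp: lessThan_Suc)
  ultimately show ?thesis using pick_unique[of "insert n I" ?f i] c i by simp
qed

text \<open>The last column is zero except for its bottom entry \<open>s\<close>, so the determinant
  splits into blocks.\<close>

lemma max_minors_ext_mat_last:
  assumes B: "B \<in> carrier_mat k n" and I: "I \<in> ksubsets k n"
  shows "max_minors (Suc k) (Suc n) (ext_mat B u s) (insert n I) = s * max_minors k n B I"
proof -
  let ?X = "select_cols (ext_mat B u s) (Suc k) (pick (insert n I))"
  have "?X = four_block_mat (select_cols B k (pick I)) (0\<^sub>m k 1)
      (mat 1 k (\<lambda>(i, j). u $ pick I j)) (mat 1 1 (\<lambda>_. s))"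
    using B pick_less[OF I] less_SucI[OF pick_less[OF I]]
    by (intro eq_matI) (auto simp: select_cols_def ext_mat_def pick_insert_last[OF I])
  moreover have "det (four_block_mat (select_cols B k (pick I)) (0\<^sub>m k 1)
      (mat 1 k (\<lambda>(i, j). u $ pick I j)) (mat 1 1 (\<lambda>_. s))) =
      det (select_cols B k (pick I)) * det (mat 1 1 (\<lambda>_. s))"
    using B by (intro det_four_block_mat_upper_right_zero) auto
  moreover have "det (mat 1 1 (\<lambda>_. s)) = s" by (simp add: det_single)
  ultimately show ?thesis
    using B I ksubsets_insert_last[OF I] by (simp add: max_minors_eq[of _ "Suc k"] max_minors_eq[of _ k])
qed

text \<open>The corner entry lies in the last column only. Hence negating \<open>s\<close> negates
  exactly the minors through that column, which is what reverses the duality sign.\<close>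

lemma max_minors_ext_mat_not_last:
  assumes B: "B \<in> carrier_mat k n" and J: "J \<in> ksubsets (Suc k) (Suc n)" and "n \<notin> J"
  shows "max_minors (Suc k) (Suc n) (ext_mat B u s) J = max_minors (Suc k) (Suc n) (ext_mat B u s') J"
proof -
  have "pick J i < n" if "i < Suc k" for i
    using pick_less[OF J that] pick_in_set_le[of i J] J that assms(3)
    by (metis (mono_tags, lifting) ksubsets_def less_antisym mem_Collect_eq)
  then have "select_cols (ext_mat B u s) (Suc k) (pick J) = select_cols (ext_mat B u s') (Suc k) (pick J)"
    using B pick_less[OF J] by (intro eq_matI) (auto simp: select_cols_def ext_mat_def)
  then show ?thesis using B J by (simp add: max_minors_eq[of _ "Suc k"])
qed

text \<open>As \<open>n\<close> is odd, the new coordinate enters the form with sign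
  \<open>-1\<close>. So the last row is isotropic precisely when the value of the form at
  \<open>u\<close> is the square of \<open>s\<close>.\<close>

lemma isotropic_rows_ext_mat_iff:
  assumes B: "B \<in> carrier_mat k n" and u: "u \<in> carrier_vec n" and "odd n"
  shows "isotropic_rows (ext_mat B u s) \<longleftrightarrow> isotropic_rows B \<and>
    (\<forall>i<k. (\<Sum>l<n. (-1) ^ l * B $$ (i, l) * u $ l) = 0) \<and> (\<Sum>l<n. (-1) ^ l * (u $ l)\<^sup>2) = s\<^sup>2"
proof -
  let ?E = "ext_mat B u s"
  let ?w = "\<lambda>i j. \<Sum>l<Suc n. (-1) ^ l * ?E $$ (i, l) * ?E $$ (j, l)"
  have 1: "?w i j = (\<Sum>l<n. (-1) ^ l * B $$ (i, l) * B $$ (j, l))" if "i < k" "j < k" for i j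
    using that B by (simp add: ext_mat_def)
  have 2: "?w i k = (\<Sum>l<n. (-1) ^ l * B $$ (i, l) * u $ l)"
    "?w k i = (\<Sum>l<n. (-1) ^ l * B $$ (i, l) * u $ l)" if "i < k" for i
    using that B by (simp_all add: ext_mat_def mult_ac)
  have 3: "?w k k = (\<Sum>l<n. (-1) ^ l * (u $ l)\<^sup>2) - s\<^sup>2"
    using B \<open>odd n\<close> by (simp add: ext_mat_def power2_eq_square mult.assoc)
  have "isotropic_rows ?E \<longleftrightarrow> (\<forall>i<Suc k. \<forall>j<Suc k. ?w i j = 0)"
    using B by (simp add: isotropic_rows_def ext_mat_def)
  also have "\<dots> \<longleftrightarrow> (\<forall>i<k. \<forall>j<k. ?w i j = 0) \<and> (\<forall>i<k. ?w i k = 0 \<and> ?w k i = 0) \<and> ?w k k = 0"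
    by (auto simp only: less_Suc_eq)
  also have "\<dots> \<longleftrightarrow> isotropic_rows B \<and>
    (\<forall>i<k. (\<Sum>l<n. (-1) ^ l * B $$ (i, l) * u $ l) = 0) \<and> (\<Sum>l<n. (-1) ^ l * (u $ l)\<^sup>2) = s\<^sup>2"
    using B 1 2 3 by (simp add: isotropic_rows_def)
  finally show ?thesis .
qed

section \<open>A normalized vector orthogonal to \<open>k\<close> given rows\<close>

lemma sum_even_support:
  fixes f :: "nat \<Rightarrow> real"
  assumes "\<And>l. odd l \<Longrightarrow> f l = 0"
  shows "(\<Sum>l < 2 * k + 1. f l) = (\<Sum>j < k + 1. f (2 * j))"
  by (induction k) (use assms in auto)

text \<open>
  The form is positive definite on the \<open>k + 1\<close> even coordinates, and \<open>k\<close> linear conditions have a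
  nonzero solution there.
\<close>

lemma positive_orthogonal_vector:
  assumes B: "B \<in> carrier_mat k (2 * k + 1)"
  obtains u where "u \<in> carrier_vec (2 * k + 1)"
    "\<And>i. i < k \<Longrightarrow> (\<Sum>l < 2 * k + 1. (-1) ^ l * B $$ (i, l) * u $ l) = 0"
    "(\<Sum>l < 2 * k + 1. (-1) ^ l * (u $ l)\<^sup>2) = (1 :: real)"
proof -
  \<comment> \<open>The \<open>k\<close> conditions on the even coordinates, padded with a zero row
    to a singular square matrix, so that a kernel vector exists.\<close>
  define C where "C = mat (k + 1) (k + 1) (\<lambda>(i, j). if i < k then B $$ (i, 2 * j) else 0)"
  have C: "C \<in> carrier_mat (k + 1) (k + 1)" by (simp add: C_def)
  have "det C = (\<Sum>j<k + 1. C $$ (k, j) * cofactor C k j)" by (rule laplace_expansion_row[OF C]) simp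
  also have "\<dots> = 0" by (intro sum.neutral) (auto simp: C_def)
  finally obtain z where z: "z \<in> carrier_vec (k + 1)" "z \<noteq> 0\<^sub>v (k + 1)" "C *\<^sub>v z = 0\<^sub>v (k + 1)"
    using det_0_iff_vec_prod_zero_field[OF C] by auto
  define t where "t = (\<Sum>j<k + 1. (z $ j)\<^sup>2)"
  have "t \<noteq> 0"
  proof
    assume "t = 0"
    then have "z $ j = 0" if "j < k + 1" for j
      using that by (auto simp: t_def sum_nonneg_eq_0_iff simp del: sum.lessThan_Suc)
    then have "z = 0\<^sub>v (k + 1)" using z(1) by (intro eq_vecI) auto
    then show False using z(2) by simp
  qed
  moreover have "t \<ge> 0" by (simp add: t_def sum_nonneg del: sum.lessThan_Suc)
  ultimately have t: "t > 0" by simp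
  \<comment> \<open>The kernel vector is spread over the even positions and normalized; the form is
    the ordinary sum of squares there.\<close>
  define u where "u = vec (2 * k + 1) (\<lambda>l. if even l then z $ (l div 2) / sqrt t else 0)"
  let ?u = "\<lambda>l. if even l then z $ (l div 2) / sqrt t else 0"
  have 1: "(\<Sum>l < 2 * k + 1. (-1) ^ l * B $$ (i, l) * u $ l) = 0" if i: "i < k" for i
  proof -
    have "(\<Sum>l < 2 * k + 1. (-1) ^ l * B $$ (i, l) * u $ l) =
      (\<Sum>l < 2 * k + 1. (-1) ^ l * B $$ (i, l) * ?u l)"
      by (intro sum.cong) (auto simp: u_def)
    also have "\<dots> = (\<Sum>j<k + 1. B $$ (i, 2 * j) * z $ j / sqrt t)"
      by (subst sum_even_support) auto
    also have "\<dots> = (C *\<^sub>v z) $ i / sqrt t"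
      using i z(1) by (simp add: C_def scalar_prod_def atLeast0LessThan sum_divide_distrib add_divide_distrib)
    also have "\<dots> = 0" using z(3) i by simp
    finally show ?thesis .
  qed
  have "(\<Sum>l < 2 * k + 1. (-1) ^ l * (u $ l)\<^sup>2) = (\<Sum>l < 2 * k + 1. (-1) ^ l * (?u l)\<^sup>2)"
    by (intro sum.cong) (auto simp: u_def)
  also have "\<dots> = (\<Sum>j<k + 1. (z $ j)\<^sup>2 / t)"
    using t by (subst sum_even_support) (auto simp: power_divide)
  also have "\<dots> = 1" using t by (simp only: t_def flip: sum_divide_distrib) simp
  finally show ?thesis using that[of u] 1 by (simp add: u_def)
qed

subsection \<open>The isomorphism\<close>

text \<open>All Pluecker vectors of \<open>V\<close> are proportional, so one nonnegative
  representative decides the sign condition.\<close>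

lemma OGr_plusI:
  assumes "V \<in> OGr k n" "k \<ge> 1" "q \<in> plucker k n V" "\<And>I. I \<in> ksubsets k n \<Longrightarrow> q I \<ge> 0"
  shows "V \<in> OGr_plus k n"
proof -
  obtain A where A: "A \<in> carrier_mat k n" "indep_rows A" "vec_space.row_space n A = V"
    using assms(1) Gr_obtain_matrix[of V k n] by (auto simp: OGr_def)
  obtain c where c: "c \<noteq> 0" "q = (\<lambda>I. c * max_minors k n A I)"
    using assms(3) plucker_row_space[OF A(1,2) assms(2)] A(3) by auto
  have "(\<forall>I \<in> ksubsets k n. p I \<ge> 0) \<or> (\<forall>I \<in> ksubsets k n. p I \<le> 0)" if p: "p \<in> plucker k n V" for p
  proof -
    obtain d where "p = (\<lambda>I. d * max_minors k n A I)"
      using p plucker_row_space[OF A(1,2) assms(2)] A(3) by auto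
    then have "\<exists>e. \<forall>I. p I = e * q I" using c by (intro exI[of _ "d / c"]) simp
    then obtain e where e: "\<And>I. p I = e * q I" by blast
    show ?thesis
      unfolding e using assms(4) mult_nonneg_nonneg[of e] mult_nonpos_nonneg[of e] linear[of 0 e]
      by blast
  qed
  then show ?thesis using assms(1) by (simp add: OGr_plus_def)
qed

text \<open>\<open>Phi k\<close> keeps the minors through the last column, which are
  \<open>s\<close> times those of \<open>B\<close>; the nonzero factor \<open>s\<close> disappears
  projectively.\<close>

lemma plucker_Phi_ext_mat:
  assumes B: "B \<in> carrier_mat k (2 * k + 1)" and ind: "indep_rows B" and k: "k \<ge> 1"
    and s: "s \<noteq> 0"
  shows "indep_rows (ext_mat B u s)"
    and "Phi k ` plucker (Suc k) (Suc (2 * k + 1)) (vec_space.row_space (Suc (2 * k + 1)) (ext_mat B u s))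
      = plucker k (2 * k + 1) (vec_space.row_space (2 * k + 1) B)"
proof -
  let ?n = "2 * k + 1" and ?E = "ext_mat B u s"
  have E: "?E \<in> carrier_mat (Suc k) (Suc ?n)" using B by (rule ext_mat_carrier)
  note mm = max_minors_ext_mat_last[OF B, of _ u s]
  obtain I where I: "I \<in> ksubsets k ?n" "max_minors k ?n B I \<noteq> 0"
    using indep_rows_nonzero_minor[OF B ind] by blast
  then have "max_minors (Suc k) (Suc ?n) ?E (insert ?n I) \<noteq> 0" using mm s by simp
  then show indE: "indep_rows ?E" by (rule nonzero_minor_indep_rows[OF E])
  have Phi: "Phi k (\<lambda>J. c * max_minors (Suc k) (Suc ?n) ?E J) = (\<lambda>I. (c * s) * max_minors k ?n B I)" for c
  proof
    fix I
    show "Phi k (\<lambda>J. c * max_minors (Suc k) (Suc ?n) ?E J) I = (c * s) * max_minors k ?n B I"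
    proof (cases "I \<in> ksubsets k ?n")
      case True
      then show ?thesis using mm[OF True] by (simp add: Phi_def)
    qed (simp add: Phi_def max_minors_def)
  qed
  have pE: "plucker (Suc k) (Suc ?n) (vec_space.row_space (Suc ?n) ?E) =
      {(\<lambda>J. c * max_minors (Suc k) (Suc ?n) ?E J) | c. c \<noteq> 0}"
    by (rule plucker_row_space[OF E indE]) simp
  show "Phi k ` plucker (Suc k) (Suc ?n) (vec_space.row_space (Suc ?n) ?E)
      = plucker k ?n (vec_space.row_space ?n B)"
    unfolding plucker_row_space[OF B ind k] pE
  proof (intro equalityI subsetI)
    fix p assume "p \<in> Phi k ` {(\<lambda>J. c * max_minors (Suc k) (Suc ?n) ?E J) | c. c \<noteq> 0}"
    then show "p \<in> {(\<lambda>I. c * max_minors k ?n B I) | c. c \<noteq> 0}" using Phi s by fastforce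
  next
    fix p assume "p \<in> {(\<lambda>I. c * max_minors k ?n B I) | c. c \<noteq> 0}"
    then obtain c where c: "c \<noteq> 0" "p = (\<lambda>I. c * max_minors k ?n B I)" by auto
    then have "p = Phi k (\<lambda>J. (c / s) * max_minors (Suc k) (Suc ?n) ?E J)" unfolding Phi using s by simp
    then show "p \<in> Phi k ` {(\<lambda>J. c * max_minors (Suc k) (Suc ?n) ?E J) | c. c \<noteq> 0}"
      using c s by fastforce
  qed
qed

text \<open>Either \<open>J\<close> or its complement contains the last index, and isotropy makes
  their minors equal up to sign. So \<open>Phi k\<close> never kills the coordinates of an isotropic
  space.\<close>

lemma isotropic_last_minor:
  assumes A: "A \<in> carrier_mat (Suc k) (2 * Suc k)" and ind: "indep_rows A" and iso: "isotropic_rows A"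
  obtains J where "J \<in> ksubsets (Suc k) (2 * Suc k)" "2 * k + 1 \<in> J"
    "max_minors (Suc k) (2 * Suc k) A J \<noteq> 0"
proof -
  obtain \<epsilon> where \<epsilon>: "\<epsilon> = 1 \<or> \<epsilon> = -1" "\<And>J. J \<in> ksubsets (Suc k) (2 * Suc k) \<Longrightarrow>
      max_minors (Suc k) (2 * Suc k) A J = \<epsilon> * max_minors (Suc k) (2 * Suc k) A ({..<2 * Suc k} - J)"
    using isotropic_complementary_minors[OF assms] by blast
  obtain J where J: "J \<in> ksubsets (Suc k) (2 * Suc k)" "max_minors (Suc k) (2 * Suc k) A J \<noteq> 0"
    using indep_rows_nonzero_minor[OF A ind] by blast
  show ?thesis
  proof (cases "2 * k + 1 \<in> J")
    case False
    then show ?thesis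
      using that[of "{..<2 * Suc k} - J"] J \<epsilon>(2)[OF J(1)] ksubsets_complement[OF J(1)] by auto
  qed (use that J in blast)
qed

lemma OGr_obtain_ext_mat:
  assumes "W \<in> OGr (Suc k) (2 * Suc k)"
  obtains B u where "B \<in> carrier_mat k (2 * k + 1)" "indep_rows B" "isotropic_rows B"
    "vec_space.row_space (2 * Suc k) (ext_mat B u 1) = W"
proof -
  let ?n = "2 * k + 1"
  have n: "2 * Suc k = Suc ?n" by simp
  obtain A where A: "A \<in> carrier_mat (Suc k) (2 * Suc k)" "indep_rows A" "isotropic_rows A"
    "vec_space.row_space (2 * Suc k) A = W"
    using OGr_obtain_matrix[OF assms] by blast
  obtain J where J: "J \<in> ksubsets (Suc k) (Suc ?n)" "?n \<in> J"
    "max_minors (Suc k) (Suc ?n) A J \<noteq> 0"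
    using isotropic_last_minor[OF A(1-3)] unfolding n by blast
  obtain G where G: "G \<in> carrier_mat (Suc k) (Suc k)"
    "det G * max_minors (Suc k) (Suc ?n) A J = 1"
    "select_cols (G * A) (Suc k) (pick J) = 1\<^sub>m (Suc k)"
    "vec_space.row_space (Suc ?n) (G * A) = vec_space.row_space (Suc ?n) A"
    using Gr_normal_form[OF A(1)[unfolded n] J(1,3)] by metis
  let ?A = "G * A"
  have A': "?A \<in> carrier_mat (Suc k) (Suc ?n)" using G A by auto
  have I: "J - {?n} \<in> ksubsets k ?n" by (rule ksubsets_remove_last[OF J(1,2)])
  have ins: "insert ?n (J - {?n}) = J" using J(2) by auto
  \<comment> \<open>The last index is the largest element of \<open>J\<close>, so it sits at
    position \<open>k\<close> and the normal form makes the last column a unit vector.\<close>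
  have pk: "pick J k = ?n" using pick_insert_last[OF I, of k] ins by simp
  have last: "?A $$ (i, ?n) = (if i = k then 1 else 0)" if "i < Suc k" for i
  proof -
    have "?A $$ (i, ?n) = select_cols ?A (Suc k) (pick J) $$ (i, k)"
      using that G(1) pk by (simp add: select_cols_def)
    then show ?thesis using G(3) that by simp
  qed
  define B where "B = mat k ?n (\<lambda>ij. ?A $$ ij)"
  define u where "u = vec ?n (\<lambda>j. ?A $$ (k, j))"
  have B: "B \<in> carrier_mat k ?n" and u: "u \<in> carrier_vec ?n" by (simp_all add: B_def u_def)
  have E: "ext_mat B u 1 = ?A"
  proof (rule eq_matI)
    fix i j assume "i < dim_row ?A" "j < dim_col ?A"
    then have ij: "i < Suc k" "j < Suc ?n" using A' by auto
    show "ext_mat B u 1 $$ (i, j) = ?A $$ (i, j)"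
    proof (cases "j = ?n")
      case True
      then show ?thesis using ij last[OF ij(1)] by (simp add: ext_mat_def B_def)
    next
      case False
      then have "j < ?n" using ij by simp
      moreover have "i < k \<or> i = k" using ij by auto
      ultimately show ?thesis by (auto simp: ext_mat_def B_def u_def)
    qed
  qed (use A' in \<open>auto simp: ext_mat_def B_def\<close>)
  have W: "vec_space.row_space (2 * Suc k) ?A = W" using G(4) A(4) by (simp only: n)
  have "isotropic_rows ?A"
    using row_space_isotropic_iff[OF A'] assms W by (simp add: OGr_def)
  then have isoB: "isotropic_rows B"
    using isotropic_rows_ext_mat_iff[OF B u, of 1] E by simp
  have "max_minors k ?n B (J - {?n}) = max_minors (Suc k) (Suc ?n) ?A J"
    using max_minors_ext_mat_last[OF B I, of u 1] E ins by simp
  also have "\<dots> = 1" using max_minors_mult[OF G(1) A(1)[unfolded n]] G(2) by simp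
  finally have "indep_rows B" by (intro nonzero_minor_indep_rows[OF B, of "J - {?n}"]) simp
  then show ?thesis using that B isoB E W by metis
qed

text \<open>\<open>V\<close> is the row space of the block \<open>B\<close> in the matrix of
  \<open>W\<close>. Its coordinates are among those of \<open>W\<close> and inherit their common
  sign.\<close>

lemma OGr_plus_std_Phi:
  assumes W: "W \<in> OGr_plus_std (Suc k)" and k: "k \<ge> 1"
  obtains V where "V \<in> OGr_plus k (2 * k + 1)"
    "plucker k (2 * k + 1) V = Phi k ` plucker (Suc k) (2 * Suc k) W"
proof -
  let ?n = "2 * k + 1"
  have n: "2 * Suc k = Suc ?n" by simp
  obtain B u where B: "B \<in> carrier_mat k ?n" "indep_rows B" "isotropic_rows B"
    and W': "vec_space.row_space (2 * Suc k) (ext_mat B u 1) = W"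
    using W OGr_obtain_ext_mat[of W k] by (auto simp: OGr_plus_std_def OGr_plus_def)
  let ?V = "vec_space.row_space ?n B"
  have P: "plucker k ?n ?V = Phi k ` plucker (Suc k) (2 * Suc k) W"
    using plucker_Phi_ext_mat(2)[OF B(1,2) k, of 1 u] W' by (simp only: n)
  have "(\<forall>I \<in> ksubsets k ?n. p I \<ge> 0) \<or> (\<forall>I \<in> ksubsets k ?n. p I \<le> 0)" if p: "p \<in> plucker k ?n ?V" for p
  proof -
    obtain q where q: "q \<in> plucker (Suc k) (2 * Suc k) W" "p = Phi k q" using p P by blast
    then have "(\<forall>J \<in> ksubsets (Suc k) (Suc ?n). q J \<ge> 0) \<or> (\<forall>J \<in> ksubsets (Suc k) (Suc ?n). q J \<le> 0)"
      using W unfolding OGr_plus_std_def OGr_plus_def n by blast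
    then show ?thesis using q(2) ksubsets_insert_last[of _ k ?n] by (auto simp: Phi_def)
  qed
  then have "?V \<in> OGr_plus k ?n" using row_space_OGr[OF B] by (simp add: OGr_plus_def)
  then show ?thesis using that P by blast
qed

lemma OGr_plus_lift:
  assumes V: "V \<in> OGr_plus k (2 * k + 1)" and k: "k \<ge> 1"
  obtains W where "W \<in> OGr_plus_std (Suc k)"
    "plucker k (2 * k + 1) V = Phi k ` plucker (Suc k) (2 * Suc k) W"
proof -
  let ?n = "2 * k + 1" and ?N = "2 * Suc k"
  have n: "?N = Suc ?n" and odd_n: "odd ?n" by simp_all
  obtain B where B: "B \<in> carrier_mat k ?n" "indep_rows B" "isotropic_rows B"
    and V': "vec_space.row_space ?n B = V"
    using V OGr_obtain_matrix[of V k ?n] by (auto simp: OGr_plus_def)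
  obtain u where u: "u \<in> carrier_vec ?n"
    "\<And>i. i < k \<Longrightarrow> (\<Sum>l < ?n. (-1) ^ l * B $$ (i, l) * u $ l) = 0"
    "(\<Sum>l < ?n. (-1) ^ l * (u $ l)\<^sup>2) = 1"
    using positive_orthogonal_vector[OF B(1)] by blast
  let ?E = "\<lambda>s. ext_mat B u s" and ?q = "\<lambda>s. max_minors (Suc k) ?N (ext_mat B u s)"
  have E: "?E s \<in> carrier_mat (Suc k) ?N" for s using ext_mat_carrier[OF B(1)] n by simp
  have iso: "isotropic_rows (?E s)" if "s = 1 \<or> s = -1" for s
  proof -
    have "s\<^sup>2 = 1" using that by auto
    then show ?thesis
      unfolding isotropic_rows_ext_mat_iff[OF B(1) u(1) odd_n] u(3) using B(3) u(2) by metis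
  qed
  have indE: "indep_rows (?E s)" if "s = 1 \<or> s = -1" for s
    using plucker_Phi_ext_mat(1)[OF B(1,2) k, of s u] that by auto
  have qlast: "?q s (insert ?n I) = s * max_minors k ?n B I" if "I \<in> ksubsets k ?n" for s I
    using max_minors_ext_mat_last[OF B(1) that, of u s] by (simp only: n)
  \<comment> \<open>The duality sign of the extension with \<open>s = 1\<close>; taking \<epsilon>
    itself as corner entry will give the standard component.\<close>
  obtain \<epsilon> where \<epsilon>: "\<epsilon> = 1 \<or> \<epsilon> = -1"
    "\<And>J. J \<in> ksubsets (Suc k) ?N \<Longrightarrow> ?q 1 J = \<epsilon> * ?q 1 ({..<?N} - J)"
    using isotropic_complementary_minors[OF E indE iso, of 1] by blast
  \<comment> \<open>Passing from corner \<open>1\<close> to corner \<epsilon> multiplies the minors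
    through the last column by \<epsilon> and fixes the others. Of \<open>J\<close> and its
    complement exactly one is affected, so the duality sign becomes one.\<close>
  have sym: "?q \<epsilon> J = ?q \<epsilon> ({..<?N} - J)" if J: "J \<in> ksubsets (Suc k) ?N" for J
  proof -
    have main: "?q \<epsilon> J = ?q \<epsilon> ({..<?N} - J)" if J: "J \<in> ksubsets (Suc k) ?N" "?n \<in> J" for J
    proof -
      have I: "J - {?n} \<in> ksubsets k ?n" "insert ?n (J - {?n}) = J"
        using ksubsets_remove_last[of J k ?n] J by auto
      have "?q \<epsilon> J = \<epsilon> * ?q 1 J" using qlast[OF I(1)] I(2) by simp
      also have "\<dots> = ?q 1 ({..<?N} - J)" using \<epsilon>(1) \<epsilon>(2)[OF J(1)] by auto
      also have "\<dots> = ?q \<epsilon> ({..<?N} - J)"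
        using max_minors_ext_mat_not_last[OF B(1), of "{..<?N} - J" u 1 \<epsilon>] ksubsets_complement[OF J(1)] J(2)
        by (simp only: n) auto
      finally show ?thesis .
    qed
    show ?thesis
    proof (cases "?n \<in> J")
      case False
      have "{..<?N} - ({..<?N} - J) = J" using J by (auto simp: ksubsets_def)
      then show ?thesis using main[OF ksubsets_complement[OF J]] False by auto
    qed (use main J in blast)
  qed
  have \<epsilon>0: "\<epsilon> \<noteq> 0" using \<epsilon>(1) by auto
  let ?W = "vec_space.row_space ?N (?E \<epsilon>)"
  have W: "?W \<in> OGr (Suc k) ?N" by (rule row_space_OGr[OF E indE iso]) (use \<epsilon>(1) in auto)
  have P: "plucker k ?n V = Phi k ` plucker (Suc k) ?N ?W"
    using plucker_Phi_ext_mat(2)[OF B(1,2) k \<epsilon>0, of u] V' by (simp only: n)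
  have pW: "plucker (Suc k) ?N ?W = {(\<lambda>J. c * ?q \<epsilon> J) | c. c \<noteq> 0}"
    by (rule plucker_row_space[OF E indE]) (use \<epsilon>(1) in auto)
  have "max_minors k ?n B \<in> plucker k ?n V" using B(1) V' by (auto simp: plucker_def)
  then have sgn: "(\<forall>I \<in> ksubsets k ?n. max_minors k ?n B I \<ge> 0) \<or> (\<forall>I \<in> ksubsets k ?n. max_minors k ?n B I \<le> 0)"
    using V by (auto simp: OGr_plus_def)
  \<comment> \<open>Since the square of \<epsilon> is one, this \<open>c\<close> makes
    \<open>c * \<epsilon>\<close> the common sign of the minors of \<open>B\<close>.\<close>
  define c where "c = (if \<forall>I \<in> ksubsets k ?n. max_minors k ?n B I \<ge> 0 then \<epsilon> else - \<epsilon>)"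
  have c: "c \<noteq> 0" "\<And>I. I \<in> ksubsets k ?n \<Longrightarrow> c * (\<epsilon> * max_minors k ?n B I) \<ge> 0"
    using \<epsilon>(1) sgn by (auto simp: c_def)
  have "c * ?q \<epsilon> J \<ge> 0" if J: "J \<in> ksubsets (Suc k) ?N" for J
  proof -
    \<comment> \<open>Minors through the last column come from \<open>B\<close>; \<open>sym\<close>
      reduces all others to these.\<close>
    have main: "c * ?q \<epsilon> J \<ge> 0" if J: "J \<in> ksubsets (Suc k) ?N" "?n \<in> J" for J
    proof -
      have I: "J - {?n} \<in> ksubsets k ?n" "insert ?n (J - {?n}) = J"
        using ksubsets_remove_last[of J k ?n] J by auto
      show ?thesis using qlast[OF I(1), of \<epsilon>] I(2) c(2)[OF I(1)] by simp
    qed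
    show ?thesis
      using main[OF J] main[OF ksubsets_complement[OF J]] sym[OF J] by (cases "?n \<in> J") auto
  qed
  then have "?W \<in> OGr_plus (Suc k) ?N"
    using c(1) pW by (intro OGr_plusI[OF W, of "\<lambda>J. c * ?q \<epsilon> J"]) auto
  moreover have "q J = q ({..<?N} - J)" if q: "q \<in> plucker (Suc k) ?N ?W" and J: "J \<in> ksubsets (Suc k) ?N" for q J
  proof -
    obtain c where "q = (\<lambda>J. c * ?q \<epsilon> J)" using q unfolding pW by blast
    then show ?thesis using sym[OF J] by metis
  qed
  ultimately have "?W \<in> OGr_plus_std (Suc k)" unfolding OGr_plus_std_def by blast
  then show ?thesis using that P by blast
qed

text \<open>The value depends only on the pair formed by \<open>J\<close> and its complement,
  matching the symmetry of the standard component, and each component is a single coordinate of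
  \<open>p\<close>.\<close>

definition Psi :: "nat \<Rightarrow> (nat set \<Rightarrow> real) \<Rightarrow> nat set \<Rightarrow> real" where
  "Psi k p J = p ((if 2 * k + 1 \<in> J then J else {..<2 * Suc k} - J) - {2 * k + 1})"

lemma Psi_index:
  assumes "J \<in> ksubsets (Suc k) (2 * Suc k)"
  shows "(if 2 * k + 1 \<in> J then J else {..<2 * Suc k} - J) - {2 * k + 1} \<in> ksubsets k (2 * k + 1)"
  using assms ksubsets_complement[OF assms] ksubsets_remove_last[of _ k "2 * k + 1"] by auto

lemma Psi_Phi:
  assumes J: "J \<in> ksubsets (Suc k) (2 * Suc k)" and sym: "q J = q ({..<2 * Suc k} - J)"
  shows "Psi k (Phi k q) J = q J"
proof -
  let ?J = "if 2 * k + 1 \<in> J then J else {..<2 * Suc k} - J"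
  have "?J - {2 * k + 1} \<union> {2 * k + 1} = ?J" by auto
  then have "Psi k (Phi k q) J = q ?J"
    using Psi_index[OF J] by (simp add: Psi_def Phi_def)
  then show ?thesis using sym by simp
qed

lemma Gr_plucker_nonzero:
  assumes "V \<in> Gr k n" "k \<ge> 1" "p \<in> plucker k n V"
  obtains I where "I \<in> ksubsets k n" "p I \<noteq> 0"
proof -
  obtain A where A: "A \<in> carrier_mat k n" "indep_rows A" "vec_space.row_space n A = V"
    using Gr_obtain_matrix[OF assms(1)] by blast
  obtain I where I: "I \<in> ksubsets k n" "max_minors k n A I \<noteq> 0"
    using indep_rows_nonzero_minor[OF A(1,2)] by blast
  obtain c where "c \<noteq> 0" "p = (\<lambda>I. c * max_minors k n A I)"
    using assms(3) plucker_row_space[OF A(1,2) assms(2)] A(3) by auto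
  then show ?thesis using that I by auto
qed

lemma plucker_support: "p \<in> plucker k n V \<Longrightarrow> I \<notin> ksubsets k n \<Longrightarrow> p I = 0"
  by (auto simp: plucker_def max_minors_def)

theorem theorem4p5:
  fixes k :: nat
  assumes "k \<ge> 1"
  shows "proj_isomorphism (ksubsets (k + 1) (2 * k + 2)) (ksubsets k (2 * k + 1))
           (plucker (k + 1) (2 * k + 2) ` OGr_plus_std (k + 1))
           (plucker k (2 * k + 1) ` OGr_plus k (2 * k + 1))
           (\<lambda>P. Phi k ` P) \<and>
         (\<exists>\<phi>. bij_betw \<phi> (OGr_plus_std (k + 1)) (OGr_plus k (2 * k + 1)) \<and>
              (\<forall>W \<in> OGr_plus_std (k + 1).
                 plucker k (2 * k + 1) (\<phi> W) = Phi k ` plucker (k + 1) (2 * k + 2) W))"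
proof -
  let ?n = "2 * k + 1" and ?N = "2 * Suc k"
  let ?S = "ksubsets (Suc k) ?N" and ?T = "ksubsets k ?n"
  let ?Q = "plucker (Suc k) ?N" and ?P = "plucker k ?n"
  let ?O = "OGr_plus_std (Suc k)" and ?U = "OGr_plus k ?n"
  have eqs: "k + 1 = Suc k" "2 * k + 2 = ?N" by auto
  have one_le: "1 \<le> Suc k" by simp
  have OG: "W \<in> Gr (Suc k) ?N" if "W \<in> ?O" for W
    using that by (simp add: OGr_plus_std_def OGr_plus_def OGr_def)
  have UG: "V \<in> Gr k ?n" if "V \<in> ?U" for V
    using that by (simp add: OGr_plus_def OGr_def)
  \<comment> \<open>On coordinate vectors of the standard component, \<open>Psi k\<close> is a left
    inverse of \<open>Phi k\<close>; the default \<open>0\<close> matches the vanishing of Pluecker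
    vectors outside the index set.\<close>
  have Psi: "(\<lambda>J. if J \<in> ?S then Psi k (Phi k q) J else 0) = q" if "W \<in> ?O" "q \<in> ?Q W" for q W
  proof
    fix J
    have "q J = q ({..<?N} - J)" if "J \<in> ?S" using \<open>W \<in> ?O\<close> \<open>q \<in> ?Q W\<close> that
      unfolding OGr_plus_std_def by blast
    then show "(if J \<in> ?S then Psi k (Phi k q) J else 0) = q J"
      using Psi_Phi[of J k q] plucker_support[OF that(2)] by auto
  qed
  have inj: "inj_on (\<lambda>P. Phi k ` P) (?Q ` ?O)"
  proof (rule inj_on_inverseI)
    fix P assume "P \<in> ?Q ` ?O"
    then obtain W where "W \<in> ?O" "P = ?Q W" by blast
    then show "(\<lambda>p J. if J \<in> ?S then Psi k p J else 0) ` Phi k ` P = P"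
      unfolding image_image using Psi[of W] by (simp cong: image_cong)
  qed
  have img: "(\<lambda>P. Phi k ` P) ` ?Q ` ?O = ?P ` ?U"
  proof (intro equalityI subsetI)
    fix X assume "X \<in> (\<lambda>P. Phi k ` P) ` ?Q ` ?O"
    then obtain W where "W \<in> ?O" "X = Phi k ` ?Q W" by blast
    then show "X \<in> ?P ` ?U" using OGr_plus_std_Phi[of W k] assms by (metis image_eqI)
  next
    fix X assume "X \<in> ?P ` ?U"
    then obtain V where "V \<in> ?U" "X = ?P V" by blast
    then show "X \<in> (\<lambda>P. Phi k ` P) ` ?Q ` ?O" using OGr_plus_lift[of V k] assms by (metis image_eqI)
  qed
  have bij: "bij_betw (\<lambda>P. Phi k ` P) (?Q ` ?O) (?P ` ?U)" using inj img by (simp add: bij_betw_def)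
  have coord: "homogeneous_poly_fun A 1 (\<lambda>x. x i)" if "i \<in> A" for A and i :: "nat set"
    using that by (rule homogeneous_poly_fun.coord)
  \<comment> \<open>One tuple of linear forms serves all points. It does not vanish, because
    \<open>Phi k q\<close> is a Pluecker vector of some \<open>V\<close>.\<close>
  have reg1: "regular_map ?S ?T (?Q ` ?O) (\<lambda>P. Phi k ` P)"
    unfolding regular_map_def
  proof (intro ballI exI conjI impI)
    fix I assume "I \<in> ?T"
    then show "homogeneous_poly_fun ?S 1 (\<lambda>q. q (I \<union> {?n}))"
      using ksubsets_insert_last[of I k ?n] by (intro coord) simp
  next
    fix P q assume "P \<in> ?Q ` ?O" "q \<in> P"
    then have "Phi k q \<in> (Phi k ` P)" "Phi k ` P \<in> ?P ` ?U" using img by blast+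
    then obtain V where "V \<in> ?U" "Phi k q \<in> ?P V" by auto
    then obtain I where "I \<in> ?T" "Phi k q I \<noteq> 0"
      using Gr_plucker_nonzero[OF UG assms] by blast
    then show "\<exists>I \<in> ?T. q (I \<union> {?n}) \<noteq> 0" by (auto simp: Phi_def)
  next
    fix P and q :: "nat set \<Rightarrow> real" assume "q \<in> P"
    then show "(\<lambda>I. if I \<in> ?T then q (I \<union> {?n}) else 0) \<in> Phi k ` P"
      by (auto simp: Phi_def)
  qed
  \<comment> \<open>The components of \<open>Psi k\<close> are again linear forms; at
    \<open>p = Phi k q\<close> they return the nonzero vector \<open>q\<close>.\<close>
  have reg2: "regular_map ?T ?S (?P ` ?U) (inv_into (?Q ` ?O) (\<lambda>P. Phi k ` P))"
    unfolding regular_map_def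
  proof (intro ballI exI conjI impI)
    fix J assume "J \<in> ?S"
    then show "homogeneous_poly_fun ?T 1 (\<lambda>p. Psi k p J)"
      unfolding Psi_def by (intro coord Psi_index)
  next
    fix Y p assume Y: "Y \<in> ?P ` ?U" and p: "p \<in> Y"
    have "Y \<in> (\<lambda>P. Phi k ` P) ` ?Q ` ?O" using Y unfolding img .
    then obtain W where W: "W \<in> ?O" "Y = Phi k ` ?Q W" by (elim imageE) simp
    have "p \<in> Phi k ` ?Q W" using p W(2) by simp
    then obtain q where q: "q \<in> ?Q W" "p = Phi k q" by (elim imageE)
    obtain J where J: "J \<in> ?S" "q J \<noteq> 0" by (rule Gr_plucker_nonzero[OF OG[OF W(1)] _ q(1)]) simp
    have "Psi k p J = q J" using fun_cong[OF Psi[OF W(1) q(1)], of J] J(1) q(2) by simp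
    then show "\<exists>J \<in> ?S. Psi k p J \<noteq> 0" using J by metis
  next
    fix Y p assume Y: "Y \<in> ?P ` ?U" and p: "p \<in> Y"
    let ?X = "inv_into (?Q ` ?O) (\<lambda>P. Phi k ` P) Y"
    have Y': "Y \<in> (\<lambda>P. Phi k ` P) ` ?Q ` ?O" using Y unfolding img .
    obtain W where W: "W \<in> ?O" "?X = ?Q W" using inv_into_into[OF Y'] by (elim imageE)
    have "p \<in> Phi k ` ?X" using f_inv_into_f[OF Y'] p by simp
    then obtain q where q: "q \<in> ?X" "p = Phi k q" by (elim imageE)
    then have "q \<in> ?Q W" using W(2) by simp
    from Psi[OF W(1) this] show "(\<lambda>J. if J \<in> ?S then Psi k p J else 0) \<in> ?X"
      unfolding q(2) using q(1) by simp
  qed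
  have "proj_isomorphism ?S ?T (?Q ` ?O) (?P ` ?U) (\<lambda>P. Phi k ` P)"
    unfolding proj_isomorphism_def
    using bij reg1 reg2 plucker_in_proj_space[OF OG one_le]
      plucker_in_proj_space[OF UG assms] by blast
  \<comment> \<open>The bijection of Pluecker points descends to the subspaces themselves, since a
    subspace is determined by its point.\<close>
  moreover have "\<exists>\<phi>. bij_betw \<phi> ?O ?U \<and> (\<forall>W \<in> ?O. ?P (\<phi> W) = Phi k ` ?Q W)"
  proof -
    have "\<exists>V. V \<in> ?U \<and> ?P V = Phi k ` ?Q W" if "W \<in> ?O" for W
      using OGr_plus_std_Phi[OF that assms] by blast
    then obtain \<phi> where \<phi>: "\<And>W. W \<in> ?O \<Longrightarrow> \<phi> W \<in> ?U \<and> ?P (\<phi> W) = Phi k ` ?Q W" by metis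
    have "inj_on \<phi> ?O"
    proof (rule inj_onI)
      fix W W' assume W: "W \<in> ?O" "W' \<in> ?O" "\<phi> W = \<phi> W'"
      then have "Phi k ` ?Q W = Phi k ` ?Q W'" using \<phi> by metis
      then have "?Q W = ?Q W'" using inj_onD[OF inj] W by blast
      then show "W = W'" using plucker_inj OG W by blast
    qed
    moreover have "\<phi> ` ?O = ?U"
    proof (intro equalityI subsetI)
      fix V assume V: "V \<in> ?U"
      then obtain W where W: "W \<in> ?O" "?P V = Phi k ` ?Q W" using OGr_plus_lift[OF V assms] by blast
      then have "?P (\<phi> W) = ?P V" using \<phi> by simp
      then have "\<phi> W = V" using plucker_inj UG V \<phi>[OF W(1)] by blast
      then show "V \<in> \<phi> ` ?O" using W by blast
    qed (use \<phi> in blast)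
    ultimately show ?thesis using \<phi> by (auto simp: bij_betw_def)
  qed
  ultimately show ?thesis unfolding eqs by blast
qed

end
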